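(* The following theories are not quasi-VC-minimal: $\mathrm{Th}(\mathbb{Q}_p; +, \cdot, |)$ for any prime $p$, and $\mathrm{Th}(k((t)); +, \cdot, |)$ for any field $k$.
   Context: $\mathbb{Q}_p$ carries its $p$-adic valuation and $k((t))$ (formal Laurent series) its $t$-adic valuation $v$; $x\mid y$ is the binary relation meaning $v(x)\le v(y)$. Directedness: for a set $X$, a family $\mathcal{B}\subseteq\mathcal{P}(X)$ is directed if for all $A,B\in\mathcal{B}$ either $A\subseteq B$, or $B\subseteq A$, or $A\cap B=\emptyset$. For a theory $T$, a set of formulas $\Psi=\{\psi_i(x;\bar y_i) : i\in I\}$ ($x$ a single variable, the parameter variables $\bar y_i$ may vary with $i$) is directed if for all $\mathfrak{M}\models T$ the family $\{\psi_i(\mathfrak{M};\bar a) : i\in I, \bar a\in M^{|\bar y_i|}\}$ is directed, where $\psi_i(\mathfrak{M};\bar a)=\{b\in M : \mathfrak{M}\models\psi_i(b;\bar a)\}$. Quasi-VC-minimality: $T$ is quasi-VC-minimal if there is a directed $\Psi$ such that every formula $\varphi(x)$ in the single variable $x$, with parameters from a model of $T$, is $T$-equivalent to a boolean combination of instances $\psi(x;\bar a)$ of formulas $\psi\in\Psi$ and parameter-free formulas in $x$. *)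

theory Defs
  imports
    "HOL-Computational_Algebra.Computational_Algebra"
    "HOL-Library.Extended"
begin

section \<open>First-order logic over the language with $+$, $\cdot$ and $\mid$\<close>

datatype tm = Var nat | Add tm tm | Mul tm tm

datatype fm = Eq tm tm | Dvd tm tm | Neg fm | Conj fm fm | Exi nat fm

primrec fv_tm :: "tm \<Rightarrow> nat set" where
  "fv_tm (Var n) = {n}"
| "fv_tm (Add s t) = fv_tm s \<union> fv_tm t"
| "fv_tm (Mul s t) = fv_tm s \<union> fv_tm t"

primrec fv :: "fm \<Rightarrow> nat set" where
  "fv (Eq s t) = fv_tm s \<union> fv_tm t"
| "fv (Dvd s t) = fv_tm s \<union> fv_tm t"
| "fv (Neg \<phi>) = fv \<phi>"
| "fv (Conj \<phi> \<psi>) = fv \<phi> \<union> fv \<psi>"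
| "fv (Exi n \<phi>) = fv \<phi> - {n}"

record 'a vstruct =
  univ :: "'a set"
  add :: "'a \<Rightarrow> 'a \<Rightarrow> 'a"
  mul :: "'a \<Rightarrow> 'a \<Rightarrow> 'a"
  divs :: "'a \<Rightarrow> 'a \<Rightarrow> bool"

definition is_structure :: "'a vstruct \<Rightarrow> bool" where
  "is_structure M \<longleftrightarrow> univ M \<noteq> {} \<and>
    (\<forall>a\<in>univ M. \<forall>b\<in>univ M. add M a b \<in> univ M \<and> mul M a b \<in> univ M)"

primrec tm_val :: "'a vstruct \<Rightarrow> (nat \<Rightarrow> 'a) \<Rightarrow> tm \<Rightarrow> 'a" where
  "tm_val M e (Var n) = e n"
| "tm_val M e (Add s t) = add M (tm_val M e s) (tm_val M e t)"
| "tm_val M e (Mul s t) = mul M (tm_val M e s) (tm_val M e t)"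

primrec sat :: "'a vstruct \<Rightarrow> (nat \<Rightarrow> 'a) \<Rightarrow> fm \<Rightarrow> bool" where
  "sat M e (Eq s t) \<longleftrightarrow> tm_val M e s = tm_val M e t"
| "sat M e (Dvd s t) \<longleftrightarrow> divs M (tm_val M e s) (tm_val M e t)"
| "sat M e (Neg \<phi>) \<longleftrightarrow> \<not> sat M e \<phi>"
| "sat M e (Conj \<phi> \<psi>) \<longleftrightarrow> sat M e \<phi> \<and> sat M e \<psi>"
| "sat M e (Exi n \<phi>) \<longleftrightarrow> (\<exists>b\<in>univ M. sat M (e(n := b)) \<phi>)"

definition assignments :: "'a vstruct \<Rightarrow> (nat \<Rightarrow> 'a) set" where
  "assignments M = {e. \<forall>n. e n \<in> univ M}"

definition sentence :: "fm \<Rightarrow> bool" where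
  "sentence \<phi> \<longleftrightarrow> fv \<phi> = {}"

definition holds :: "'a vstruct \<Rightarrow> fm \<Rightarrow> bool" where
  "holds M \<phi> \<longleftrightarrow> (\<forall>e\<in>assignments M. sat M e \<phi>)"

definition Th :: "'a vstruct \<Rightarrow> fm set" where
  "Th M = {\<phi>. sentence \<phi> \<and> holds M \<phi>}"

definition models :: "'a vstruct \<Rightarrow> fm set \<Rightarrow> bool" where
  "models M T \<longleftrightarrow> is_structure M \<and> (\<forall>\<phi>\<in>T. holds M \<phi>)"


section \<open>Quasi-VC-minimality\<close>

text \<open>
  In a formula regarded as $\psi(x;\bar y)$, the variable $x$ is number 0 and all other free
  variables are the parameter variables $\bar y$. A parameter tuple is given by a whole assignment
  \<open>a\<close>, of which only the finitely many values at $\bar y$ matter (the value at 0 is overwritten).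
\<close>

definition solset :: "'a vstruct \<Rightarrow> fm \<Rightarrow> (nat \<Rightarrow> 'a) \<Rightarrow> 'a set" where
  "solset M \<psi> a = {b \<in> univ M. sat M (a(0 := b)) \<psi>}"

definition directed_family :: "'a set set \<Rightarrow> bool" where
  "directed_family \<B> \<longleftrightarrow> (\<forall>A\<in>\<B>. \<forall>B\<in>\<B>. A \<subseteq> B \<or> B \<subseteq> A \<or> A \<inter> B = {})"

definition instances :: "'a vstruct \<Rightarrow> fm set \<Rightarrow> 'a set set" where
  "instances M \<Psi> = {solset M \<psi> a | \<psi> a. \<psi> \<in> \<Psi> \<and> a \<in> assignments M}"

definition parameter_free_sets :: "'a vstruct \<Rightarrow> 'a set set" where
  "parameter_free_sets M = {solset M \<theta> a | \<theta> a. fv \<theta> \<subseteq> {0} \<and> a \<in> assignments M}"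

text \<open>
  HOL cannot quantify over the models in all types at once: the models considered here are those
  whose universe is a subset of the type \<open>'m\<close>. Restricting the models makes the notion weaker, hence
  its negation stronger. For infinite \<open>'m\<close> nothing is lost: the language is countable, so by the
  downward Loewenheim-Skolem theorem every model, with any given finite tuple of parameters, has a
  countable elementary submodel, and that has a copy in \<open>'m\<close>.
\<close>

definition directed_formulas :: "'m itself \<Rightarrow> fm set \<Rightarrow> fm set \<Rightarrow> bool" where
  "directed_formulas _ T \<Psi> \<longleftrightarrow>
    (\<forall>M :: 'm vstruct. models M T \<longrightarrow> directed_family (instances M \<Psi>))"

inductive_set bool_comb :: "'a set \<Rightarrow> 'a set set \<Rightarrow> 'a set set"
  for U :: "'a set" and G :: "'a set set" where
  gen: "A \<in> G \<Longrightarrow> A \<in> bool_comb U G"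
| compl: "A \<in> bool_comb U G \<Longrightarrow> U - A \<in> bool_comb U G"
| inter: "A \<in> bool_comb U G \<Longrightarrow> B \<in> bool_comb U G \<Longrightarrow> A \<inter> B \<in> bool_comb U G"

text \<open>
  Two formulas with parameters from \<open>M\<close> are \<open>T\<close>-equivalent when they are equivalent in \<open>M\<close> (hence in
  every elementary extension), that is, when they have the same solution set in \<open>M\<close>.
\<close>

definition quasi_VC_minimal :: "'m itself \<Rightarrow> fm set \<Rightarrow> bool" where
  "quasi_VC_minimal ty T \<longleftrightarrow>
    (\<exists>\<Psi>. directed_formulas ty T \<Psi> \<and>
      (\<forall>M :: 'm vstruct. models M T \<longrightarrow>
        (\<forall>\<phi>. \<forall>a\<in>assignments M.
          solset M \<phi> a \<in> bool_comb (univ M) (instances M \<Psi> \<union> parameter_free_sets M))))"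


section \<open>Valued fields as structures\<close>

definition valued_structure ::
  "'a set \<Rightarrow> ('a \<Rightarrow> 'a \<Rightarrow> 'a) \<Rightarrow> ('a \<Rightarrow> 'a \<Rightarrow> 'a) \<Rightarrow> ('a \<Rightarrow> int extended) \<Rightarrow> 'a vstruct" where
  "valued_structure U pl ti v =
    \<lparr>univ = U, add = pl, mul = ti, divs = (\<lambda>x y. v x \<le> v y)\<rparr>"


subsection \<open>The field of $p$-adic numbers\<close>

definition rat_val :: "nat \<Rightarrow> rat \<Rightarrow> int extended" where
  "rat_val p x = (if x = 0 then Pinf
     else Fin (int (multiplicity (int p) (fst (quotient_of x)))
             - int (multiplicity (int p) (snd (quotient_of x)))))"

text \<open>
  $\mathbb{Q}_p$ is the completion of $\mathbb{Q}$ with respect to the $p$-adic valuation: Cauchy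
  sequences of rationals modulo null sequences.
\<close>

definition padic_Cauchy :: "nat \<Rightarrow> (nat \<Rightarrow> rat) set" where
  "padic_Cauchy p = {x. \<forall>k. \<exists>N. \<forall>m\<ge>N. \<forall>n\<ge>N. Fin k \<le> rat_val p (x m - x n)}"

definition padic_null :: "nat \<Rightarrow> (nat \<Rightarrow> rat) set" where
  "padic_null p = {x. \<forall>k. \<exists>N. \<forall>n\<ge>N. Fin k \<le> rat_val p (x n)}"

definition padic_rel :: "nat \<Rightarrow> ((nat \<Rightarrow> rat) \<times> (nat \<Rightarrow> rat)) set" where
  "padic_rel p = {(x, y). x \<in> padic_Cauchy p \<and> y \<in> padic_Cauchy p \<and> (\<lambda>n. x n - y n) \<in> padic_null p}"

definition padic_carrier :: "nat \<Rightarrow> (nat \<Rightarrow> rat) set set" where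
  "padic_carrier p = padic_Cauchy p // padic_rel p"

definition padic_add ::
  "nat \<Rightarrow> (nat \<Rightarrow> rat) set \<Rightarrow> (nat \<Rightarrow> rat) set \<Rightarrow> (nat \<Rightarrow> rat) set" where
  "padic_add p A B = (\<Union>x\<in>A. \<Union>y\<in>B. padic_rel p `` {\<lambda>n. x n + y n})"

definition padic_mul ::
  "nat \<Rightarrow> (nat \<Rightarrow> rat) set \<Rightarrow> (nat \<Rightarrow> rat) set \<Rightarrow> (nat \<Rightarrow> rat) set" where
  "padic_mul p A B = (\<Union>x\<in>A. \<Union>y\<in>B. padic_rel p `` {\<lambda>n. x n * y n})"

text \<open>
  Along a Cauchy sequence that is not null, the valuation is eventually constant; this constant is
  the valuation of its class. The class of 0 is the set of null sequences.
\<close>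

definition padic_val :: "nat \<Rightarrow> (nat \<Rightarrow> rat) set \<Rightarrow> int extended" where
  "padic_val p A = (if A = padic_null p then Pinf
     else (THE w. \<forall>x\<in>A. \<exists>N. \<forall>n\<ge>N. rat_val p (x n) = w))"

definition Qp :: "nat \<Rightarrow> (nat \<Rightarrow> rat) set vstruct" where
  "Qp p = valued_structure (padic_carrier p) (padic_add p) (padic_mul p) (padic_val p)"


subsection \<open>Formal Laurent series\<close>

text \<open>The library sets \<open>fls_subdegree 0 = 0\<close>, whereas the valuation of 0 is infinite.\<close>

definition fls_val :: "'k::field fls \<Rightarrow> int extended" where
  "fls_val f = (if f = 0 then Pinf else Fin (fls_subdegree f))"

definition laurent :: "'k::field fls vstruct" where
  "laurent = valued_structure UNIV (+) (*) fls_val"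

end

theory Submission
  imports Defs "HOL-Library.Countable_Set"
begin

text \<open>
  Consider \<open>\<phi>(x; y)\<close>: ``\<open>v(x - y)\<close> is even''. Suppose that every instance of \<open>\<phi>\<close> is a boolean
  combination of at most \<open>s\<close> members of a directed family and of \<open>s\<close> fixed sets. A finite set of
  points can be listed, cell by cell of the fixed sets, such that every member of the family is
  convex in each cell; so along the list each instance of \<open>\<phi>\<close> changes its truth value boundedly
  often. On the leaves of a full binary tree of depth \<open>n\<close>, however, two neighbours in the list that
  split at level \<open>j\<close> are separated by \<open>\<phi>(x; a)\<close> for about \<open>2^(n - j)\<close> leaves \<open>a\<close>, and any list
  passing through all leaves has at least \<open>2^(l + 1) - 1\<close> steps that split at a level \<open>\<le> l\<close>. The
  average number of changes is therefore of order \<open>n\<close>.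

  The bound \<open>s\<close> is made uniform without a compactness argument: by the downward Loewenheim-Skolem
  theorem, the hypothesis holds in the complete field itself, which contains a copy of the Cantor
  space of digit sequences. By the Baire category theorem, some \<open>s\<close> works for parameters that are
  dense in a ball, and this provides trees of every depth.
\<close>

section \<open>Enumerations of a finite set with few changes\<close>

fun changes :: "'a list \<Rightarrow> nat" where
  "changes (x # y # zs) = (if x = y then 0 else 1) + changes (y # zs)"
| "changes _ = 0"

lemma changes_append: "changes (xs @ ys) \<le> changes xs + changes ys + 1"
proof (induction xs rule: changes.induct)
  case ("2_2" x)
  then show ?case by (cases ys) auto
qed auto

lemma changes_constant: "(\<And>x. x \<in> set xs \<Longrightarrow> x = c) \<Longrightarrow> changes xs = 0"
  by (induction xs rule: changes.induct) auto

text \<open>Every value after the first must be entered by a change. This gives the lower bound on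
  changes for lists that run through all prefixes of a given length.\<close>

lemma card_set_le_changes: "card (set xs) \<le> changes xs + 1"
  by (induction xs rule: changes.induct) (auto simp: card_insert_if insert_absorb)

definition convex_in :: "'a list \<Rightarrow> 'a set \<Rightarrow> bool" where
  "convex_in xs B \<longleftrightarrow>
    (\<exists>us vs ws. xs = us @ vs @ ws \<and> set us \<inter> B = {} \<and> set vs \<subseteq> B \<and> set ws \<inter> B = {})"

lemma convex_in_disjoint: "set xs \<inter> B = {} \<Longrightarrow> convex_in xs B"
  unfolding convex_in_def by (rule exI[of _ xs], rule exI[of _ "[]"], rule exI[of _ "[]"]) auto

lemma convex_in_superset: "set xs \<subseteq> B \<Longrightarrow> convex_in xs B"
  unfolding convex_in_def by (rule exI[of _ "[]"], rule exI[of _ xs], rule exI[of _ "[]"]) auto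

lemma convex_in_append1: "convex_in xs B \<Longrightarrow> set ys \<inter> B = {} \<Longrightarrow> convex_in (xs @ ys) B"
  unfolding convex_in_def
  by (elim exE conjE, rule_tac x = us in exI, rule_tac x = vs in exI, rule_tac x = "ws @ ys" in exI)
    auto

lemma convex_in_append2: "convex_in ys B \<Longrightarrow> set xs \<inter> B = {} \<Longrightarrow> convex_in (xs @ ys) B"
  unfolding convex_in_def
  by (elim exE conjE, rule_tac x = "xs @ us" in exI, rule_tac x = vs in exI, rule_tac x = ws in exI)
    auto

lemma convex_in_changes:
  assumes "convex_in xs B"
  shows "changes (map (\<lambda>x. x \<in> B) xs) \<le> 2"
proof -
  obtain us vs ws where xs: "xs = us @ vs @ ws" "set us \<inter> B = {}" "set vs \<subseteq> B" "set ws \<inter> B = {}"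
    using assms unfolding convex_in_def by blast
  have "changes (map (\<lambda>x. x \<in> B) us) = 0" "changes (map (\<lambda>x. x \<in> B) ws) = 0"
    using xs by (auto intro!: changes_constant[where c = False])
  moreover have "changes (map (\<lambda>x. x \<in> B) vs) = 0"
    using xs by (auto intro!: changes_constant[where c = True])
  ultimately show ?thesis
    using changes_append[of "map (\<lambda>x. x \<in> B) us" "map (\<lambda>x. x \<in> B) (vs @ ws)"]
      changes_append[of "map (\<lambda>x. x \<in> B) vs" "map (\<lambda>x. x \<in> B) ws"] xs(1) by simp
qed

text \<open>Among the members of \<open>\<F>\<close> that cut \<open>A\<close> properly, one with
  the largest trace is enumerated first and the rest of \<open>A\<close> after it, both by
  induction. Any other member lies inside it, misses it or contains it; in the last case maximality
  makes its trace the same or all of \<open>A\<close>.\<close>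

lemma directed_convex_enumeration:
  assumes "finite A" "directed_family \<F>"
  shows "\<exists>xs. set xs = A \<and> (\<forall>B\<in>\<F>. convex_in xs B)"
  using assms(1)
proof (induction "card A" arbitrary: A rule: less_induct)
  case less
  show ?case
  proof (cases "\<exists>B\<in>\<F>. B \<inter> A \<noteq> {} \<and> B \<inter> A \<noteq> A")
    case False
    obtain xs where xs: "set xs = A"
      using less.prems finite_list by blast
    have "convex_in xs B" if "B \<in> \<F>" for B
    proof (cases "B \<inter> A = {}")
      case True
      then show ?thesis
        using xs by (intro convex_in_disjoint) auto
    next
      case False
      then have "B \<inter> A = A"
        using that \<open>\<not> (\<exists>B\<in>\<F>. _ B)\<close> by blast
      then show ?thesis
        using xs by (intro convex_in_superset) auto
    qed
    then show ?thesis
      using xs by blast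
  next
    case True
    define Q where "Q B \<longleftrightarrow> B \<in> \<F> \<and> B \<inter> A \<noteq> {} \<and> B \<inter> A \<noteq> A" for B
    obtain B0 where "Q B0"
      using True Q_def by blast
    moreover have "\<forall>C. Q C \<longrightarrow> card (C \<inter> A) < card A + 1"
      using less.prems by (auto simp: less_Suc_eq_le intro!: card_mono)
    ultimately have "\<exists>B. Q B \<and> (\<forall>C. Q C \<longrightarrow> card (C \<inter> A) \<le> card (B \<inter> A))"
      by (rule Lattices_Big.ex_has_greatest_nat)
    then obtain B where B: "Q B" and max: "\<And>C. Q C \<Longrightarrow> card (C \<inter> A) \<le> card (B \<inter> A)"
      by blast
    have psub: "B \<inter> A \<subset> A" "A - B \<subset> A"
      using B unfolding Q_def by auto
    obtain xs where xs: "set xs = B \<inter> A" "\<forall>C\<in>\<F>. convex_in xs C"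
      using less.hyps[OF psubset_card_mono[OF less.prems psub(1)]] less.prems by auto
    obtain ys where ys: "set ys = A - B" "\<forall>C\<in>\<F>. convex_in ys C"
      using less.hyps[OF psubset_card_mono[OF less.prems psub(2)]] less.prems by auto
    have "convex_in (xs @ ys) C" if C: "C \<in> \<F>" for C
    proof -
      consider "C \<subseteq> B" | "B \<subseteq> C" | "B \<inter> C = {}"
        using assms(2) B C unfolding directed_family_def Q_def by blast
      then show ?thesis
      proof cases
        case 1
        then show ?thesis
          using xs ys C by (intro convex_in_append1) auto
      next
        case 2
        show ?thesis
        proof (cases "C \<inter> A = A")
          case True
          then show ?thesis
            using xs ys by (intro convex_in_superset) auto
        next
          case False
          then have "Q C"
            using B C 2 unfolding Q_def by auto
          then have "C \<inter> A = B \<inter> A"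
            using max[of C] 2 less.prems by (intro card_seteq[symmetric]) auto
          then show ?thesis
            using xs ys C by (intro convex_in_append1) auto
        qed
      next
        case 3
        then show ?thesis
          using xs ys C by (intro convex_in_append2) auto
      qed
    qed
    moreover have "set (xs @ ys) = A"
      using xs ys by auto
    ultimately show ?thesis
      by blast
  qed
qed

text \<open>Each set of \<open>\<Theta>\<close> cuts \<open>A\<close> in two, and the halves are
  enumerated separately and joined. The new set is constant on both halves and the junction costs at
  most one change, so a bound K becomes 2K + 1. Starting from the 2 changes of a convex set, this
  recursion gives \<open>3 * 2 ^ card \<Theta> - 1\<close>.\<close>

lemma few_changes_enumeration:
  fixes \<Theta> :: "'a set set"
  assumes "finite \<Theta>" "finite A" "directed_family \<F>"
  shows "\<exists>xs. set xs = A \<and>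
    (\<forall>B\<in>\<F> \<union> \<Theta>. changes (map (\<lambda>x. x \<in> B) xs) \<le> 3 * 2 ^ card \<Theta> - 1)"
  using assms(1,2)
proof (induction \<Theta> arbitrary: A rule: finite_induct)
  case empty
  then show ?case
    using directed_convex_enumeration[OF _ assms(3), of A] by (force dest: convex_in_changes)
next
  case (insert C \<Theta>)
  let ?K = "3 * 2 ^ card \<Theta> - 1 :: nat"
  obtain xs where xs: "set xs = A \<inter> C" "\<forall>B\<in>\<F> \<union> \<Theta>. changes (map (\<lambda>x. x \<in> B) xs) \<le> ?K"
    using insert.IH[of "A \<inter> C"] insert.prems by auto
  obtain ys where ys: "set ys = A - C" "\<forall>B\<in>\<F> \<union> \<Theta>. changes (map (\<lambda>x. x \<in> B) ys) \<le> ?K"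
    using insert.IH[of "A - C"] insert.prems by auto
  have "changes (map (\<lambda>x. x \<in> C) xs) = 0"
    using xs by (auto intro!: changes_constant[where c = True])
  moreover have "changes (map (\<lambda>x. x \<in> C) ys) = 0"
    using ys by (auto intro!: changes_constant[where c = False])
  ultimately have le: "changes (map (\<lambda>x. x \<in> B) xs) \<le> ?K" "changes (map (\<lambda>x. x \<in> B) ys) \<le> ?K"
    if "B \<in> \<F> \<union> insert C \<Theta>" for B
    using xs(2) ys(2) that by auto
  \<comment> \<open>Splitting the power into zero and successor disposes of the truncated
    subtraction.\<close>
  have K: "?K + ?K + 1 = 3 * 2 ^ card (insert C \<Theta>) - 1"
    using insert.hyps by (cases "2 ^ card \<Theta> :: nat") auto
  have "changes (map (\<lambda>x. x \<in> B) (xs @ ys)) \<le> 3 * 2 ^ card (insert C \<Theta>) - 1"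
    if "B \<in> \<F> \<union> insert C \<Theta>" for B
    using changes_append[of "map (\<lambda>x. x \<in> B) xs" "map (\<lambda>x. x \<in> B) ys"] le[OF that]
    unfolding K[symmetric] by simp
  moreover have "set (xs @ ys) = A"
    using xs ys by auto
  ultimately show ?case
    by blast
qed

section \<open>Boolean combinations and their changes of truth value\<close>

lemma bool_comb_mono:
  "Y \<in> bool_comb U H \<Longrightarrow> H \<subseteq> H' \<Longrightarrow> Y \<in> bool_comb U H'"
  by (induction rule: bool_comb.induct) (auto intro: bool_comb.intros)

lemma bool_comb_finite:
  "X \<in> bool_comb U G \<Longrightarrow> \<exists>H\<subseteq>G. finite H \<and> X \<in> bool_comb U H"
proof (induction rule: bool_comb.induct)
  case (gen A)
  then show ?case
    by (intro exI[of _ "{A}"]) (auto intro: bool_comb.gen)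
next
  case (inter A B)
  obtain H1 H2 where "H1 \<subseteq> G" "finite H1" "A \<in> bool_comb U H1"
    "H2 \<subseteq> G" "finite H2" "B \<in> bool_comb U H2"
    using inter.IH by blast
  then show ?case
    by (intro exI[of _ "H1 \<union> H2"]) (auto intro!: bool_comb.inter elim: bool_comb_mono)
qed (auto intro: bool_comb.compl)

text \<open>Complement within \<open>U\<close> and intersection cannot tell apart two points of
  \<open>U\<close> on which all generators agree.\<close>

lemma bool_comb_separates:
  assumes "X \<in> bool_comb U G" "x \<in> U" "y \<in> U" "(x \<in> X) \<noteq> (y \<in> X)"
  shows "\<exists>B\<in>G. (x \<in> B) \<noteq> (y \<in> B)"
  using assms by (induction rule: bool_comb.induct) auto

text \<open>Wherever \<open>X\<close> changes between two neighbours some generator changes too, so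
  each change of \<open>X\<close> is paid for by one of a generator. The list holds indices
  \<open>u\<close> of points \<open>q u\<close>; later these indices are words.\<close>

lemma changes_bool_comb:
  assumes "X \<in> bool_comb U G" "finite G" "\<And>u. q u \<in> U"
  shows "changes (map (\<lambda>u. q u \<in> X) us) \<le> (\<Sum>B\<in>G. changes (map (\<lambda>u. q u \<in> B) us))"
proof (induction us rule: induct_list012)
  case (3 u v us)
  have "(if (q u \<in> X) = (q v \<in> X) then 0 else 1) \<le>
      (\<Sum>B\<in>G. if (q u \<in> B) = (q v \<in> B) then 0 else 1::nat)"
  proof (cases "(q u \<in> X) = (q v \<in> X)")
    case False
    then obtain B where "B \<in> G" "(q u \<in> B) \<noteq> (q v \<in> B)"
      using bool_comb_separates[OF assms(1,3,3)] by blast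
    then show ?thesis
      using assms(2) by (subst sum.remove[of _ B]) auto
  qed simp
  then show ?case
    using 3 by (simp add: sum.distrib add_mono)
qed auto

section \<open>Separation by parity on a binary tree\<close>

definition words :: "nat \<Rightarrow> bool list set" where
  "words n = {u. length u = n}"

lemma finite_words: "finite (words n)" and card_words: "card (words n) = 2 ^ n"
  using finite_lists_length_eq[of "UNIV :: bool set" n] card_lists_length_eq[of "UNIV :: bool set" n]
  by (simp_all add: words_def)

lemma take_words: "l \<le> n \<Longrightarrow> take l ` words n = words l"
proof (intro set_eqI iffI)
  fix u assume "l \<le> n" "u \<in> words l"
  then show "u \<in> take l ` words n"
    by (intro image_eqI[of _ _ "u @ replicate (n - l) True"]) (auto simp: words_def)
qed (auto simp: words_def)

text \<open>Stated for functions, so that it covers infinite digit sequences as well as words, which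
  are read through \<open>(!)\<close>.\<close>

definition splits_at :: "nat \<Rightarrow> (nat \<Rightarrow> 'a) \<Rightarrow> (nat \<Rightarrow> 'a) \<Rightarrow> bool" where
  "splits_at j f g \<longleftrightarrow> (\<forall>i<j. f i = g i) \<and> f j \<noteq> g j"

lemma sum_powers_le: "(\<Sum>l<m. if j \<le> l then 2 ^ (m - Suc l) else (0::nat)) \<le> 2 ^ (m - j)"
proof -
  have "(\<Sum>l<m. if j \<le> l then 2 ^ (m - Suc l) else (0::nat)) = (\<Sum>l<m. if l < m - j then 2 ^ l else 0)"
    by (subst sum.nat_diff_reindex[symmetric]) (auto intro!: sum.cong)
  also have "\<dots> = (\<Sum>l<m - j. 2 ^ l)"
    by (subst sum.inter_filter[symmetric]) (auto intro!: sum.cong)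
  also have "(\<Sum>l<n. 2 ^ l) \<le> (2::nat) ^ n" for n
    by (induction n) auto
  finally show ?thesis .
qed

text \<open>The points \<open>a\<close> that leave \<open>x\<close> one level below the splitting of \<open>x\<close> and \<open>y\<close> suffice.\<close>

lemma parity_separation:
  fixes R :: "bool list \<Rightarrow> bool list \<Rightarrow> bool"
  assumes R: "\<And>u v j. u \<in> words (m + 2) \<Longrightarrow> v \<in> words (m + 2) \<Longrightarrow> j < m + 2 \<Longrightarrow>
      splits_at j ((!) u) ((!) v) \<Longrightarrow> R u v \<longleftrightarrow> even (d + j)"
    and xy: "x \<in> words (m + 2)" "y \<in> words (m + 2)"
  shows "(\<Sum>l<m. if take (Suc l) x = take (Suc l) y then 0 else 2 ^ (m - Suc l))
    \<le> card {a \<in> words (m + 2). R x a \<noteq> R y a}" (is "?S \<le> card ?C")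
proof (cases "\<exists>l<m. take (Suc l) x \<noteq> take (Suc l) y")
  case False
  then show ?thesis by simp
next
  case True
  then obtain l where l: "l < m" "take (Suc l) x \<noteq> take (Suc l) y"
    by blast
  have "\<exists>j\<le>l. x ! j \<noteq> y ! j"
    using l xy by (auto simp: words_def list_eq_iff_nth_eq less_Suc_eq_le)
  then obtain k where k: "k < m" "x ! k \<noteq> y ! k"
    using l by (meson le_less_trans)
  define j where "j = (LEAST k. x ! k \<noteq> y ! k)"
  have j: "x ! j \<noteq> y ! j" "j \<le> k" "\<And>i. i < j \<Longrightarrow> x ! i = y ! i"
    using LeastI[of "\<lambda>k. x ! k \<noteq> y ! k", OF k(2)] Least_le[of "\<lambda>k. x ! k \<noteq> y ! k", OF k(2)]
      not_less_Least[of _ "\<lambda>k. x ! k \<noteq> y ! k"] unfolding j_def by blast+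
  have jm: "j < m"
    using j k by simp
  \<comment> \<open>\<open>h v\<close> follows \<open>x\<close> through level \<open>j\<close> and
    leaves it at the next one. It thus splits from \<open>y\<close> at \<open>j\<close> and from
    \<open>x\<close> at \<open>Suc j\<close>, levels of opposite parity. The \<open>m - j\<close>
    remaining bits are free, and the total length is (j + 1) + 1 + (m - j) = m + 2.\<close>
  define h where "h v = take (Suc j) x @ [\<not> x ! Suc j] @ v" for v
  have h_words: "h v \<in> words (m + 2)" if "v \<in> words (m - j)" for v
    using that jm xy by (auto simp: h_def words_def)
  have nth_h: "h v ! i = (if i \<le> j then x ! i else \<not> x ! Suc j)" if "i \<le> Suc j" for i v
    using that jm xy by (auto simp: h_def nth_append words_def)
  have "h v \<in> ?C" if "v \<in> words (m - j)" for v
  proof -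
    have "splits_at (Suc j) ((!) x) ((!) (h v))" "splits_at j ((!) y) ((!) (h v))"
      using j nth_h[of _ v] by (auto simp: splits_at_def)
    then have "R x (h v) \<longleftrightarrow> even (d + Suc j)" "R y (h v) \<longleftrightarrow> even (d + j)"
      using R[OF xy(1) h_words[OF that], of "Suc j"] R[OF xy(2) h_words[OF that], of j] jm
      by simp_all
    then show ?thesis
      using h_words[OF that] by simp
  qed
  then have "card (words (m - j)) \<le> card ?C"
    by (intro card_inj_on_le[where f = h]) (auto simp: inj_on_def h_def finite_words)
  \<comment> \<open>Prefixes that end before level \<open>j\<close> agree, so only the levels from
    \<open>j\<close> on contribute.\<close>
  moreover have "?S \<le> (\<Sum>l<m. if j \<le> l then 2 ^ (m - Suc l) else (0::nat))"
  proof (intro sum_mono)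
    fix l assume "l \<in> {..<m}"
    moreover have "take (Suc l) x = take (Suc l) y" if "l < j" "l < m"
      using that j(3) xy by (auto simp: words_def list_eq_iff_nth_eq)
    ultimately show "(if take (Suc l) x = take (Suc l) y then 0 else 2 ^ (m - Suc l))
        \<le> (if j \<le> l then 2 ^ (m - Suc l) else (0::nat))"
      by auto
  qed
  ultimately show ?thesis
    using sum_powers_le[of j m] by (simp add: card_words)
qed

text \<open>Double counting over the neighbouring pairs of \<open>xs\<close>: a pair contributes to
  the left the weights \<open>c l\<close> of the levels that separate it, and to the right the
  number of \<open>a\<close> that separate it.\<close>

lemma sum_changes_ge:
  assumes "finite A"
    and "\<And>x y. x \<in> set xs \<Longrightarrow> y \<in> set xs \<Longrightarrow>
      (\<Sum>l<m. if f l x = f l y then 0 else c l) \<le> card {a \<in> A. R x a \<noteq> R y a}"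
  shows "(\<Sum>l<m. c l * changes (map (f l) xs)) \<le> (\<Sum>a\<in>A. changes (map (\<lambda>x. R x a) xs))"
  using assms(2)
proof (induction xs rule: induct_list012)
  case (3 x y zs)
  have "(\<Sum>l<m. c l * changes (map (f l) (x # y # zs))) =
      (\<Sum>l<m. if f l x = f l y then 0 else c l) + (\<Sum>l<m. c l * changes (map (f l) (y # zs)))"
    by (subst sum.distrib[symmetric]) (auto intro!: sum.cong)
  also have "\<dots> \<le> card {a \<in> A. R x a \<noteq> R y a} + (\<Sum>a\<in>A. changes (map (\<lambda>x. R x a) (y # zs)))"
    using 3 by (intro add_mono) auto
  also have "card {a \<in> A. R x a \<noteq> R y a} = (\<Sum>a\<in>A. if R x a = R y a then 0 else 1)"
    using assms(1) by (subst card_eq_sum, subst sum.inter_filter) (auto intro!: sum.cong)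
  also have "\<dots> + (\<Sum>a\<in>A. changes (map (\<lambda>x. R x a) (y # zs))) =
      (\<Sum>a\<in>A. changes (map (\<lambda>x. R x a) (x # y # zs)))"
    by (subst sum.distrib[symmetric]) simp
  finally show ?case .
qed auto

text \<open>All \<open>2 ^ Suc l\<close> prefixes of length \<open>Suc l\<close> occur along the
  list, so these prefixes change at least \<open>2 ^ Suc l - 1\<close> times. Weighted by
  \<open>2 ^ (m - Suc l)\<close> and summed over \<open>l < m\<close>, this is at least
  \<open>(m - 1) * 2 ^ m\<close>, while the words \<open>a\<close> allow at most
  \<open>2 ^ (m + 2) * K\<close> changes. The offset \<open>d\<close> accounts for a common stem
  above the tree.\<close>

lemma parity_many_changes:
  fixes R :: "bool list \<Rightarrow> bool list \<Rightarrow> bool"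
  assumes R: "\<And>u v j. u \<in> words (m + 2) \<Longrightarrow> v \<in> words (m + 2) \<Longrightarrow> j < m + 2 \<Longrightarrow>
      splits_at j ((!) u) ((!) v) \<Longrightarrow> R u v \<longleftrightarrow> even (d + j)"
    and xs: "set xs = words (m + 2)"
    and K: "\<And>a. a \<in> words (m + 2) \<Longrightarrow> changes (map (\<lambda>x. R x a) xs) \<le> K"
  shows "m \<le> 4 * K + 1"
proof -
  have "2 ^ (m - Suc l) * (2 ^ Suc l - 1) \<le>
      2 ^ (m - Suc l) * changes (map (take (Suc l)) xs)" if "l < m" for l
  proof -
    have "card (set (map (take (Suc l)) xs)) = 2 ^ Suc l"
      using that xs take_words[of "Suc l" "m + 2"] by (simp add: card_words)
    then show ?thesis
      using card_set_le_changes[of "map (take (Suc l)) xs"] by (intro mult_left_mono) auto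
  qed
  then have "(\<Sum>l<m. 2 ^ (m - Suc l) * (2 ^ Suc l - 1)) \<le>
      (\<Sum>l<m. 2 ^ (m - Suc l) * changes (map (take (Suc l)) xs))"
    by (intro sum_mono) auto
  also have "\<dots> \<le> (\<Sum>a\<in>words (m + 2). changes (map (\<lambda>x. R x a) xs))"
    using parity_separation[OF R] xs by (intro sum_changes_ge finite_words) auto
  also have "\<dots> \<le> of_nat (card (words (m + 2))) * K"
    by (intro sum_bounded_above K)
  finally have "(\<Sum>l<m. 2 ^ (m - Suc l) * (2 ^ Suc l - 1)) \<le> 2 ^ m * (4 * K)"
    by (simp add: card_words)
  \<comment> \<open>Adding the geometric sum back removes the truncated \<open>- 1\<close>: each
    level then contributes exactly \<open>2 ^ m\<close>.\<close>
  moreover have "(\<Sum>l<m. 2 ^ (m - Suc l) * (2 ^ Suc l - 1)) + (\<Sum>l<m. 2 ^ (m - Suc l)) = m * 2 ^ m"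
  proof -
    have "2 ^ (m - Suc l) * (2 ^ Suc l - 1) + 2 ^ (m - Suc l) = (2::nat) ^ m" if "l < m" for l
    proof -
      have "2 ^ (m - Suc l) * (2 ^ Suc l - 1) + 2 ^ (m - Suc l) = (2::nat) ^ (m - Suc l) * 2 ^ Suc l"
        by (simp add: algebra_simps)
      also have "\<dots> = 2 ^ m"
        using that by (subst power_add[symmetric]) simp
      finally show ?thesis .
    qed
    then show ?thesis
      by (subst sum.distrib[symmetric]) simp
  qed
  moreover have "(\<Sum>l<m. 2 ^ (m - Suc l)) \<le> (2::nat) ^ m"
    using sum_powers_le[of 0 m] by simp
  ultimately have "2 ^ m * m \<le> 2 ^ m * (4 * K + 1)"
    by (simp add: algebra_simps)
  then show ?thesis
    by (simp only: nat_mult_le_cancel_disj) simp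
qed

section \<open>The Baire category theorem for sequences\<close>

definition extends :: "(nat \<Rightarrow> 'a) \<Rightarrow> 'a list \<Rightarrow> bool" where
  "extends f w \<longleftrightarrow> (\<forall>i<length w. f i = w ! i)"

text \<open>Otherwise every word \<open>w\<close> has, for every \<open>s\<close>, an extension
  whose cylinder misses \<open>B s\<close>. Passing to such an extension for s = 0, 1, 2, ... in
  turn produces a sequence in the limit that lies in no \<open>B s\<close>.\<close>

lemma Baire_sequences:
  fixes B :: "nat \<Rightarrow> (nat \<Rightarrow> 'a) set"
  assumes "(\<Union>s. B s) = UNIV"
  shows "\<exists>s w. \<forall>u. \<exists>f\<in>B s. extends f (w @ u)"
proof (rule ccontr)
  assume "\<not> ?thesis"
  then have "\<forall>s w. \<exists>u. \<forall>f\<in>B s. \<not> extends f (w @ u)"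
    by blast
  then obtain h where h: "\<And>s w f. f \<in> B s \<Longrightarrow> \<not> extends f (w @ h s w)"
    by metis
  \<comment> \<open>The extra letter makes \<open>W\<close> grow even where \<open>h s w\<close> is
    empty, so that the limit is determined at every index.\<close>
  define W where "W = rec_nat [] (\<lambda>s w. w @ h s w @ [undefined])"
  have W_Suc: "W (Suc s) = W s @ h s (W s) @ [undefined]" for s
    by (simp add: W_def)
  have len: "s \<le> length (W s)" for s
    by (induction s) (auto simp: W_Suc)
  have stable: "i < length (W s) \<Longrightarrow> i < length (W (s + t)) \<and> W (s + t) ! i = W s ! i" for i s t
    by (induction t) (auto simp: W_Suc nth_append)
  define f where "f i = W (Suc i) ! i" for i
  have f: "f i = W s ! i" if "i < length (W s)" for i s
    using stable[OF that, of "Suc i"] stable[of i "Suc i" s] len[of "Suc i"]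
    by (simp add: f_def add.commute)
  obtain s where "f \<in> B s"
    using assms by blast
  moreover have "extends f (W s @ h s (W s))"
    using f[of _ "Suc s"] by (auto simp: extends_def W_Suc nth_append)
  ultimately show False
    using h by blast
qed


section \<open>Downward Loewenheim-Skolem\<close>

text \<open>Countability of the language serves twice: it keeps Skolem hulls countable and it
  numbers the parameter-free formulas.\<close>

instance tm :: countable by countable_datatype
instance fm :: countable by countable_datatype

lemma tm_val_cong: "(\<And>n. n \<in> fv_tm t \<Longrightarrow> e n = e' n) \<Longrightarrow> tm_val M e t = tm_val M e' t"
  by (induction t) auto

lemma sat_cong: "(\<And>n. n \<in> fv \<phi> \<Longrightarrow> e n = e' n) \<Longrightarrow> sat M e \<phi> = sat M e' \<phi>"
proof (induction \<phi> arbitrary: e e')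
  case (Exi n \<phi>)
  then have "sat M (e(n := b)) \<phi> = sat M (e'(n := b)) \<phi>" for b
    by (intro Exi.IH) auto
  then show ?case by simp
next
  case (Eq s t)
  then show ?case
    using tm_val_cong[of s e e' M] tm_val_cong[of t e e' M] by auto
next
  case (Dvd s t)
  then show ?case
    using tm_val_cong[of s e e' M] tm_val_cong[of t e e' M] by auto
next
  case (Conj \<phi> \<psi>)
  have "sat M e \<phi> = sat M e' \<phi>" "sat M e \<psi> = sat M e' \<psi>"
    using Conj.prems by (intro Conj.IH; simp)+
  then show ?case by simp
next
  case (Neg \<phi>)
  have "sat M e \<phi> = sat M e' \<phi>"
    using Neg.prems by (intro Neg.IH) simp
  then show ?case by simp
qed

lemma finite_fv_tm: "finite (fv_tm t)"
  by (induction t) auto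

lemma finite_fv: "finite (fv \<phi>)"
  by (induction \<phi>) (auto simp: finite_fv_tm)

section \<open>Renaming of variables\<close>

primrec rename_tm :: "(nat \<Rightarrow> nat) \<Rightarrow> tm \<Rightarrow> tm" where
  "rename_tm f (Var n) = Var (f n)"
| "rename_tm f (Add s t) = Add (rename_tm f s) (rename_tm f t)"
| "rename_tm f (Mul s t) = Mul (rename_tm f s) (rename_tm f t)"

primrec rename :: "(nat \<Rightarrow> nat) \<Rightarrow> fm \<Rightarrow> fm" where
  "rename f (Eq s t) = Eq (rename_tm f s) (rename_tm f t)"
| "rename f (Dvd s t) = Dvd (rename_tm f s) (rename_tm f t)"
| "rename f (Neg \<phi>) = Neg (rename f \<phi>)"
| "rename f (Conj \<phi> \<psi>) = Conj (rename f \<phi>) (rename f \<psi>)"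
| "rename f (Exi n \<phi>) = Exi (f n) (rename f \<phi>)"

lemma tm_val_rename: "tm_val M e (rename_tm f t) = tm_val M (e \<circ> f) t"
  by (induction t) auto

text \<open>Renaming bound variables along with the free ones by an injection excludes capture.\<close>

lemma sat_rename: "inj f \<Longrightarrow> sat M e (rename f \<phi>) = sat M (e \<circ> f) \<phi>"
proof (induction \<phi> arbitrary: e)
  case (Exi n \<phi>)
  then have "e(f n := b) \<circ> f = (e \<circ> f)(n := b)" for b
    by (auto simp: fun_eq_iff inj_eq)
  then show ?case
    using Exi.IH[OF Exi.prems] by (simp only: rename.simps sat.simps)
qed (auto simp: tm_val_rename)

text \<open>Moving the variables of one formula to even numbers and those of the other to odd
  numbers lets a single assignment carry both parameter tuples. Both renamings fix 0, the solution
  variable. The same new formulas serve for \<open>M\<close> and, along \<open>h\<close>, for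
  \<open>N\<close>.\<close>

lemma solset_merge:
  fixes M :: "'a vstruct" and N :: "'b vstruct" and h :: "'a \<Rightarrow> 'b"
  assumes "e1 \<in> assignments M" "e2 \<in> assignments M"
  obtains \<chi>1 \<chi>2 e where "e \<in> assignments M"
    and "solset N \<chi>1 (h \<circ> e) = solset N \<phi> (h \<circ> e1)"
    and "solset N \<chi>2 (h \<circ> e) = solset N \<psi> (h \<circ> e2)"
    and "solset M \<chi>1 e = solset M \<phi> e1" and "solset M \<chi>2 e = solset M \<psi> e2"
proof
  define f1 f2 :: "nat \<Rightarrow> nat" where "f1 n = 2 * n" and "f2 n = (if n = 0 then 0 else 2 * n + 1)" for n
  define e where "e n = (if even n then e1 (n div 2) else e2 (n div 2))" for n
  have inj: "inj f1" "inj f2"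
    by (auto simp: f1_def f2_def inj_def split: if_splits)
  show "e \<in> assignments M"
    using assms by (auto simp: e_def assignments_def)
  have 1: "((h \<circ> e)(0 := b)) \<circ> f1 = (h \<circ> e1)(0 := b)"
    "((h \<circ> e)(0 := b)) \<circ> f2 = (h \<circ> e2)(0 := b)" for b
    by (auto simp: fun_eq_iff f1_def f2_def e_def)
  have 2: "(e(0 := b)) \<circ> f1 = e1(0 := b)" "(e(0 := b)) \<circ> f2 = e2(0 := b)" for b
    by (auto simp: fun_eq_iff f1_def f2_def e_def)
  show "solset N (rename f1 \<phi>) (h \<circ> e) = solset N \<phi> (h \<circ> e1)"
    "solset N (rename f2 \<psi>) (h \<circ> e) = solset N \<psi> (h \<circ> e2)"
    by (simp_all add: solset_def sat_rename inj 1)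
  show "solset M (rename f1 \<phi>) e = solset M \<phi> e1" "solset M (rename f2 \<psi>) e = solset M \<psi> e2"
    by (simp_all add: solset_def sat_rename inj 2)
qed

section \<open>Elementary embeddings\<close>

text \<open>Preservation of \<open>Eq\<close> in both directions makes \<open>h\<close> injective on
  \<open>univ N\<close>.\<close>

definition elementary_embedding :: "('m \<Rightarrow> 'a) \<Rightarrow> 'm vstruct \<Rightarrow> 'a vstruct \<Rightarrow> bool" where
  "elementary_embedding h N M \<longleftrightarrow> is_structure N \<and> h ` univ N \<subseteq> univ M \<and>
    (\<forall>\<phi>. \<forall>e\<in>assignments N. sat N e \<phi> = sat M (h \<circ> e) \<phi>)"

lemma elementary_embedding_assignments:
  "elementary_embedding h N M \<Longrightarrow> e \<in> assignments N \<Longrightarrow> h \<circ> e \<in> assignments M"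
  unfolding elementary_embedding_def assignments_def by auto

lemma elementary_embedding_solset:
  assumes "elementary_embedding h N M" "b \<in> univ N" "e \<in> assignments N"
  shows "b \<in> solset N \<phi> e \<longleftrightarrow> h b \<in> solset M \<phi> (h \<circ> e)"
proof -
  have "e(0 := b) \<in> assignments N"
    using assms by (auto simp: assignments_def)
  moreover have "h \<circ> e(0 := b) = (h \<circ> e)(0 := h b)"
    by auto
  ultimately show ?thesis
    using assms unfolding elementary_embedding_def solset_def by (auto simp: fun_upd_def comp_def)
qed

lemma models_elementary_embedding:
  assumes "elementary_embedding h N M"
  shows "models N (Th M)"
  using assms elementary_embedding_assignments[OF assms]
  unfolding models_def Th_def holds_def elementary_embedding_def by blast

text \<open>
  A list gives the first values of an assignment, which is constant \<open>c\<close> from there on. There are only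
  countably many lists over a countable set, in contrast to arbitrary assignments.
\<close>

definition witness :: "'a vstruct \<Rightarrow> 'a \<Rightarrow> fm \<times> nat \<times> 'a list \<Rightarrow> 'a" where
  "witness M c = (\<lambda>(\<phi>, n, l).
    let P = (\<lambda>b. b \<in> univ M \<and> sat M ((\<lambda>k. if k < length l then l ! k else c)(n := b)) \<phi>)
    in if Ex P then SOME b. P b else c)"

primrec Skolem_hull :: "'a vstruct \<Rightarrow> 'a \<Rightarrow> 'a set \<Rightarrow> nat \<Rightarrow> 'a set" where
  "Skolem_hull M c C 0 = insert c C"
| "Skolem_hull M c C (Suc k) =
    Skolem_hull M c C k \<union> witness M c ` (UNIV \<times> UNIV \<times> lists (Skolem_hull M c C k))"

lemma countable_Skolem_hull: "countable C \<Longrightarrow> countable (Skolem_hull M c C k)"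
  by (induction k) (simp_all add: countable_lists)

lemma witness_in: "c \<in> univ M \<Longrightarrow> witness M c x \<in> univ M"
  by (cases x) (auto simp: witness_def Let_def dest!: someI_ex)

lemma Skolem_hull_subset: "c \<in> univ M \<Longrightarrow> C \<subseteq> univ M \<Longrightarrow> Skolem_hull M c C k \<subseteq> univ M"
  by (induction k) (auto simp: witness_in)

lemma Skolem_hull_mono: "k \<le> l \<Longrightarrow> Skolem_hull M c C k \<subseteq> Skolem_hull M c C l"
  by (rule lift_Suc_mono_le) auto

text \<open>This is the Tarski-Vaught condition. Only finitely many values of \<open>e\<close>
  matter for \<open>\<phi>\<close>; they lie in a common stage of the hull, and the next stage
  contains the chosen witness for them.\<close>

lemma Skolem_hull_closed:
  assumes "\<And>n. e n \<in> (\<Union>k. Skolem_hull M c C k)" "b \<in> univ M" "sat M (e(n := b)) \<phi>"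
  shows "\<exists>b\<in>\<Union>k. Skolem_hull M c C k. sat M (e(n := b)) \<phi>"
proof -
  obtain m where m: "fv \<phi> \<subseteq> {..<m}"
    using finite_fv[of \<phi>] finite_nat_iff_bounded by blast
  have "\<forall>n. \<exists>k. e n \<in> Skolem_hull M c C k"
    using assms(1) by simp
  then obtain f where f: "\<And>n. e n \<in> Skolem_hull M c C (f n)"
    by metis
  \<comment> \<open>Inserting 0 keeps the maximum meaningful for \<open>m = 0\<close>.\<close>
  define K where "K = Max (insert 0 (f ` {..<m}))"
  have "e i \<in> Skolem_hull M c C K" if "i < m" for i
  proof -
    have "f i \<le> K"
      using that unfolding K_def by (intro Max_ge) auto
    from Skolem_hull_mono[OF this] f[of i] show ?thesis
      by (rule subsetD)
  qed
  then have l: "map e [0..<m] \<in> lists (Skolem_hull M c C K)"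
    by auto
  have cong: "sat M ((\<lambda>k. if k < m then map e [0..<m] ! k else c)(n := b)) \<phi> = sat M (e(n := b)) \<phi>" for b
    using m by (intro sat_cong) auto
  define P where "P b \<longleftrightarrow> b \<in> univ M \<and> sat M (e(n := b)) \<phi>" for b
  have "P (SOME b. P b)"
    using assms(2,3) by (intro someI[of P b]) (auto simp: P_def)
  moreover have "witness M c (\<phi>, n, map e [0..<m]) = (SOME b. P b)"
    using assms(2,3) unfolding witness_def by (auto simp: Let_def cong P_def)
  moreover have "witness M c (\<phi>, n, map e [0..<m]) \<in> Skolem_hull M c C (Suc K)"
    using l by (auto simp del: map_eq_conv)
  ultimately show ?thesis
    unfolding P_def by (metis UN_I UNIV_I)
qed

text \<open>The union \<open>H\<close> of the Skolem stages over \<open>C\<close> is countable and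
  satisfies the Tarski-Vaught condition. The infinite type \<open>'m\<close> has room for a copy of
  \<open>H\<close>, to which the structure is transported.\<close>

lemma Loewenheim_Skolem:
  fixes M :: "'a vstruct"
  assumes inf: "infinite (UNIV :: 'm set)" and M: "is_structure M"
    and C: "C \<subseteq> univ M" "countable C"
  shows "\<exists>(N :: 'm vstruct) h. elementary_embedding h N M \<and> C \<subseteq> h ` univ N"
proof -
  obtain c where c: "c \<in> univ M"
    using M unfolding is_structure_def by blast
  define H where "H = (\<Union>k. Skolem_hull M c C k)"
  have "insert c C \<subseteq> H"
    using UN_upper[of 0 UNIV "Skolem_hull M c C"] unfolding H_def by simp
  then have H: "C \<subseteq> H" "c \<in> H" "H \<subseteq> univ M" "countable H"
    using Skolem_hull_subset[OF c C(1)] countable_Skolem_hull[OF C(2)]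
    unfolding H_def by (simp_all add: UN_least)
  note closed = Skolem_hull_closed[where M = M and c = c and C = C, folded H_def]
  obtain g :: "nat \<Rightarrow> 'm" where g: "inj g"
    using inf infinite_countable_subset by blast
  define i where "i = g \<circ> to_nat_on H"
  define h where "h = inv_into H i"
  have i: "inj_on i H"
    using H(4) g inj_on_to_nat_on[of H] unfolding i_def by (intro comp_inj_on) (auto simp: inj_on_def)
  have hi: "h (i x) = x" if "x \<in> H" for x
    using that i by (simp add: h_def)
  define N where "N = \<lparr>univ = i ` H, add = \<lambda>x y. i (add M (h x) (h y)),
    mul = \<lambda>x y. i (mul M (h x) (h y)), divs = \<lambda>x y. divs M (h x) (h y)\<rparr>"
  have add_closed: "add M x y \<in> H" and mul_closed: "mul M x y \<in> H" if "x \<in> H" "y \<in> H" for x y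
  proof -
    \<comment> \<open>With \<open>x\<close> at variable 0 and \<open>y\<close> at variable 1, the
      sum and the product are the only witnesses of an existential formula, so closure under
      witnesses puts them into \<open>H\<close>.\<close>
    define e where "e = (\<lambda>_. x)(Suc 0 := y)"
    have e: "\<And>n. e n \<in> H"
      using that by (auto simp: e_def)
    have "add M x y \<in> univ M" "mul M x y \<in> univ M"
      using M H(3) that unfolding is_structure_def by blast+
    then show "add M x y \<in> H" "mul M x y \<in> H"
      using closed[where e = e and n = 2 and \<phi> = "Eq (Var 2) (Add (Var 0) (Var (Suc 0)))", OF e]
        closed[where e = e and n = 2 and \<phi> = "Eq (Var 2) (Mul (Var 0) (Var (Suc 0)))", OF e]
      by (simp_all add: e_def)
  qed
  have is_str: "is_structure N"
    using H(2) by (auto simp: is_structure_def N_def hi add_closed mul_closed)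
  have hN: "h x \<in> H" if "x \<in> univ N" for x
    using that by (auto simp: N_def hi)
  have tm_val: "h (tm_val N e t) = tm_val M (h \<circ> e) t \<and> tm_val N e t \<in> univ N"
    if "e \<in> assignments N" for e t
    using that
    by (induction t) (auto simp: assignments_def, auto simp: N_def hi add_closed mul_closed)
  have inj_h: "h x = h y \<longleftrightarrow> x = y" if "x \<in> univ N" "y \<in> univ N" for x y
    using that by (auto simp: N_def hi)
  have "sat N e \<phi> = sat M (h \<circ> e) \<phi>" if "e \<in> assignments N" for e \<phi>
    using that
  proof (induction \<phi> arbitrary: e)
    case (Eq s t)
    then show ?case
      using tm_val[OF Eq] inj_h by (metis sat.simps(1))
  next
    case (Dvd s t)
    have "divs N x y = divs M (h x) (h y)" for x y
      by (simp add: N_def)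
    then show ?case
      using tm_val[OF Dvd] by (simp only: sat.simps)
  next
    case (Exi n \<phi>)
    have upd: "h \<circ> e(n := b) = (h \<circ> e)(n := h b)" for b
      by auto
    have IH: "sat N (e(n := b)) \<phi> = sat M ((h \<circ> e)(n := h b)) \<phi>" if "b \<in> univ N" for b
    proof -
      have "e(n := b) \<in> assignments N"
        using Exi.prems that by (simp add: assignments_def)
      then show ?thesis
        using Exi.IH upd by metis
    qed
    have he: "(h \<circ> e) n \<in> H" for n
      using Exi.prems hN by (auto simp: assignments_def)
    have "sat N e (Exi n \<phi>) \<longleftrightarrow> (\<exists>b\<in>H. sat M ((h \<circ> e)(n := b)) \<phi>)"
      using IH by (simp add: N_def hi)
    also have "\<dots> \<longleftrightarrow> sat M (h \<circ> e) (Exi n \<phi>)"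
      using closed[where e = "h \<circ> e", OF he] H(3) by (simp only: sat.simps) blast
    finally show ?case .
  qed auto
  then have "elementary_embedding h N M"
    using is_str hN H(3) unfolding elementary_embedding_def by blast
  moreover have "C \<subseteq> h ` univ N"
    using H(1) by (force simp: N_def hi image_image)
  ultimately show ?thesis
    by blast
qed

lemma elementary_pullback:
  assumes "elementary_embedding h N M" "range a \<subseteq> h ` univ N"
  obtains a' where "a' \<in> assignments N" "h \<circ> a' = a"
proof
  have "a n \<in> h ` univ N" for n
    using assms(2) by blast
  then have inv: "inv_into (univ N) h (a n) \<in> univ N" "h (inv_into (univ N) h (a n)) = a n" for n
    by (simp_all only: inv_into_into f_inv_into_f)
  show "inv_into (univ N) h \<circ> a \<in> assignments N" "h \<circ> (inv_into (univ N) h \<circ> a) = a"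
    using inv by (auto simp: assignments_def)
qed

section \<open>Transfer of quasi-VC-minimality to a structure over another type\<close>

text \<open>A failure of directedness is witnessed by three points and two parameter assignments.
  These are countably many elements, so the failure already shows in an elementary submodel over
  \<open>'m\<close>.\<close>

lemma directed_formulas_transfer:
  fixes M :: "'a vstruct"
  assumes inf: "infinite (UNIV :: 'm set)" and M: "is_structure M"
    and dir: "directed_formulas TYPE('m) (Th M) \<Psi>"
  shows "directed_family (instances M \<Psi>)"
  unfolding directed_family_def
proof (intro ballI, rule ccontr)
  fix A B assume "A \<in> instances M \<Psi>" "B \<in> instances M \<Psi>"
  then obtain \<psi>1 a1 \<psi>2 a2 where A: "A = solset M \<psi>1 a1" "\<psi>1 \<in> \<Psi>" "a1 \<in> assignments M"
    and B: "B = solset M \<psi>2 a2" "\<psi>2 \<in> \<Psi>" "a2 \<in> assignments M"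
    unfolding instances_def by blast
  assume "\<not> (A \<subseteq> B \<or> B \<subseteq> A \<or> A \<inter> B = {})"
  then obtain x y z where xyz: "x \<in> A" "x \<notin> B" "y \<in> B" "y \<notin> A" "z \<in> A" "z \<in> B"
    by blast
  have "{x, y, z} \<union> range a1 \<union> range a2 \<subseteq> univ M"
    using A B xyz by (auto simp: solset_def assignments_def)
  then obtain N :: "'m vstruct" and h where N: "elementary_embedding h N M"
    and sub: "{x, y, z} \<union> range a1 \<union> range a2 \<subseteq> h ` univ N"
    using Loewenheim_Skolem[OF inf M, of "{x, y, z} \<union> range a1 \<union> range a2"] by auto
  obtain x' y' z' where xyz': "x = h x'" "y = h y'" "z = h z'" "x' \<in> univ N" "y' \<in> univ N" "z' \<in> univ N"
    using sub by auto
  obtain b1 where b1: "b1 \<in> assignments N" "h \<circ> b1 = a1"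
    using elementary_pullback[OF N, of a1] sub by auto
  obtain b2 where b2: "b2 \<in> assignments N" "h \<circ> b2 = a2"
    using elementary_pullback[OF N, of a2] sub by auto
  let ?A = "solset N \<psi>1 b1" and ?B = "solset N \<psi>2 b2"
  have "u \<in> ?A \<longleftrightarrow> h u \<in> A" "u \<in> ?B \<longleftrightarrow> h u \<in> B" if "u \<in> univ N" for u
    using elementary_embedding_solset[OF N that] b1 b2 A B by metis+
  then have "\<not> (?A \<subseteq> ?B \<or> ?B \<subseteq> ?A \<or> ?A \<inter> ?B = {})"
    using xyz xyz' by blast
  moreover have "?A \<in> instances N \<Psi>" "?B \<in> instances N \<Psi>"
    using A B b1 b2 unfolding instances_def by blast+
  ultimately show False
    using dir models_elementary_embedding[OF N]
    unfolding directed_formulas_def directed_family_def by blast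
qed

text \<open>Equality of sets can only be transferred along \<open>h\<close> once both sides are
  given by formulas. Hence the combination is recorded as a formula \<open>\<chi>\<close>, built
  from \<open>Neg\<close> and \<open>Conj\<close> in step with the combination, such that
  \<open>\<chi>\<close> also describes a combination in \<open>M\<close>.\<close>

lemma bool_comb_formula:
  assumes "elementary_embedding h N M"
    and "S \<in> bool_comb (univ N) (instances N \<Psi> \<union> parameter_free_sets N)"
  shows "\<exists>\<chi>. \<exists>e\<in>assignments N. S = solset N \<chi> e \<and>
    solset M \<chi> (h \<circ> e) \<in> bool_comb (univ M) (instances M \<Psi> \<union> parameter_free_sets M)"
  using assms(2)
proof (induction rule: bool_comb.induct)
  case (gen A)
  have "h \<circ> e \<in> assignments M" if "e \<in> assignments N" for e
    using elementary_embedding_assignments[OF assms(1) that] .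
  then show ?case
    using gen unfolding instances_def parameter_free_sets_def by (blast intro: bool_comb.gen)
next
  case (compl A)
  then obtain \<chi> e where e: "e \<in> assignments N" "A = solset N \<chi> e"
    "solset M \<chi> (h \<circ> e) \<in> bool_comb (univ M) (instances M \<Psi> \<union> parameter_free_sets M)"
    by blast
  have "solset M (Neg \<chi>) (h \<circ> e) = univ M - solset M \<chi> (h \<circ> e)"
    by (auto simp: solset_def)
  moreover have "solset N (Neg \<chi>) e = univ N - A"
    using e(2) by (auto simp: solset_def)
  ultimately show ?case
    using bool_comb.compl[OF e(3)] e(1) by metis
next
  case (inter A B)
  then obtain \<chi>1 e1 \<chi>2 e2 where e: "e1 \<in> assignments N" "e2 \<in> assignments N"
    and A: "A = solset N \<chi>1 e1"
    "solset M \<chi>1 (h \<circ> e1) \<in> bool_comb (univ M) (instances M \<Psi> \<union> parameter_free_sets M)"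
    and B: "B = solset N \<chi>2 e2"
    "solset M \<chi>2 (h \<circ> e2) \<in> bool_comb (univ M) (instances M \<Psi> \<union> parameter_free_sets M)"
    by blast
  obtain \<theta>1 \<theta>2 e where e': "e \<in> assignments N"
    "solset M \<theta>1 (h \<circ> e) = solset M \<chi>1 (h \<circ> e1)" "solset M \<theta>2 (h \<circ> e) = solset M \<chi>2 (h \<circ> e2)"
    "solset N \<theta>1 e = solset N \<chi>1 e1" "solset N \<theta>2 e = solset N \<chi>2 e2"
    by (rule solset_merge[OF e, where N = M and h = h and \<phi> = \<chi>1 and \<psi> = \<chi>2])
  have N: "solset N (Conj \<theta>1 \<theta>2) e = A \<inter> B"
    using A B e' by (auto simp: solset_def)
  have M: "solset M (Conj \<theta>1 \<theta>2) (h \<circ> e) = solset M \<chi>1 (h \<circ> e1) \<inter> solset M \<chi>2 (h \<circ> e2)"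
    unfolding e'(2,3)[symmetric] by (auto simp: solset_def)
  show ?case
    using N M bool_comb.inter[OF A(2) B(2)] e'(1) by metis
qed

text \<open>The formula states that the symmetric difference has an element. It does not depend on
  the structure, so elementarity applies to the comparison of two solution sets.\<close>

lemma sat_symmetric_difference:
  "sat M e (Exi 0 (Neg (Conj (Neg (Conj \<phi> (Neg \<psi>))) (Neg (Conj \<psi> (Neg \<phi>)))))) \<longleftrightarrow>
    solset M \<phi> e \<noteq> solset M \<psi> e"
  by (simp add: solset_def set_eq_iff) blast

text \<open>An elementary submodel over \<open>'m\<close> that contains the parameters expresses the
  instance by a combination \<open>\<chi>\<close>. That the two solution sets coincide is a
  first-order statement about the parameters, so it passes up to \<open>M\<close>, where
  \<open>\<chi>\<close> is again a combination.\<close>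

lemma quasi_VC_minimal_transfer:
  fixes M :: "'a vstruct"
  assumes inf: "infinite (UNIV :: 'm set)" and M: "is_structure M"
    and qvc: "quasi_VC_minimal TYPE('m) (Th M)"
  obtains \<Psi> where "directed_family (instances M \<Psi>)"
    and "\<And>\<phi> a. a \<in> assignments M \<Longrightarrow>
      solset M \<phi> a \<in> bool_comb (univ M) (instances M \<Psi> \<union> parameter_free_sets M)"
proof -
  obtain \<Psi> where dir: "directed_formulas TYPE('m) (Th M) \<Psi>"
    and comb: "\<And>(N :: 'm vstruct) \<phi> a. models N (Th M) \<Longrightarrow> a \<in> assignments N \<Longrightarrow>
      solset N \<phi> a \<in> bool_comb (univ N) (instances N \<Psi> \<union> parameter_free_sets N)"
    using qvc unfolding quasi_VC_minimal_def by blast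
  have "solset M \<phi> a \<in> bool_comb (univ M) (instances M \<Psi> \<union> parameter_free_sets M)"
    if a: "a \<in> assignments M" for \<phi> a
  proof -
    have "range a \<subseteq> univ M"
      using a by (auto simp: assignments_def)
    then obtain N :: "'m vstruct" and h where N: "elementary_embedding h N M"
      and sub: "range a \<subseteq> h ` univ N"
      using Loewenheim_Skolem[OF inf M, of "range a"] by auto
    obtain b where b: "b \<in> assignments N" "h \<circ> b = a"
      using elementary_pullback[OF N sub] .
    obtain \<chi> e where e: "e \<in> assignments N" "solset N \<phi> b = solset N \<chi> e"
      and \<chi>: "solset M \<chi> (h \<circ> e) \<in> bool_comb (univ M) (instances M \<Psi> \<union> parameter_free_sets M)"
      using bool_comb_formula[OF N comb[OF models_elementary_embedding[OF N] b(1)]] by blast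
    obtain \<theta>1 \<theta>2 d where d: "d \<in> assignments N"
      "solset M \<theta>1 (h \<circ> d) = solset M \<phi> (h \<circ> b)" "solset M \<theta>2 (h \<circ> d) = solset M \<chi> (h \<circ> e)"
      "solset N \<theta>1 d = solset N \<phi> b" "solset N \<theta>2 d = solset N \<chi> e"
      by (rule solset_merge[OF b(1) e(1), where N = M and h = h and \<phi> = \<phi> and \<psi> = \<chi>])
    \<comment> \<open>The same \<open>\<delta>\<close> must serve in \<open>N\<close> and in
      \<open>M\<close>.\<close>
    obtain \<delta> where differ: "sat N d \<delta> \<longleftrightarrow> solset N \<theta>1 d \<noteq> solset N \<theta>2 d"
      "sat M (h \<circ> d) \<delta> \<longleftrightarrow> solset M \<theta>1 (h \<circ> d) \<noteq> solset M \<theta>2 (h \<circ> d)"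
      by (rule that[OF sat_symmetric_difference sat_symmetric_difference])
    have "\<not> sat N d \<delta>"
      using d(4,5) e(2) differ by simp
    then have "\<not> sat M (h \<circ> d) \<delta>"
      using N d(1) unfolding elementary_embedding_def by blast
    then have "solset M \<theta>1 (h \<circ> d) = solset M \<theta>2 (h \<circ> d)"
      using differ by blast
    then show ?thesis
      using \<chi> d b by simp
  qed
  then show ?thesis
    using that[OF directed_formulas_transfer[OF inf M dir]] by simp
qed

section \<open>The criterion against quasi-VC-minimality\<close>

lemma solset_parameter_free:
  assumes "fv \<theta> \<subseteq> {0}"
  shows "solset M \<theta> a = solset M \<theta> a'"
proof -
  have "sat M (a(0 := b)) \<theta> = sat M (a'(0 := b)) \<theta>" for b
    using assms by (intro sat_cong) auto
  then show ?thesis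
    by (simp add: solset_def)
qed

text \<open>It remains to supply a copy \<open>P\<close> of the Cantor space in \<open>M\<close> and
  a formula that detects the parity of splitting levels. Baire category yields one bound
  \<open>s\<close> on a dense set of parameters below \<open>w\<close>; there the upper and lower
  bounds for changes collide.\<close>

lemma not_quasi_VC_minimal:
  fixes M :: "'a vstruct"
  assumes inf: "infinite (UNIV :: 'm set)" and M: "is_structure M"
    and P: "\<And>f :: nat \<Rightarrow> bool. P f \<in> univ M"
    and \<phi>: "\<And>f g j. splits_at j f g \<Longrightarrow> P f \<in> solset M \<phi> (\<lambda>_. P g) \<longleftrightarrow> even j"
  shows "\<not> quasi_VC_minimal TYPE('m) (Th M)"
proof
  assume "quasi_VC_minimal TYPE('m) (Th M)"
  then obtain \<Psi> where dir: "directed_family (instances M \<Psi>)"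
    and comb: "\<And>\<phi> a. a \<in> assignments M \<Longrightarrow>
      solset M \<phi> a \<in> bool_comb (univ M) (instances M \<Psi> \<union> parameter_free_sets M)"
    using quasi_VC_minimal_transfer[OF inf M] by metis
  define X where "X f = solset M \<phi> (\<lambda>_. P f)" for f
  define T where "T \<theta> = solset M \<theta> (\<lambda>_. P (\<lambda>_. True))" for \<theta>
  \<comment> \<open>Formulas with further free variables are listed as well; what counts is that
    \<open>D s\<close> is finite and independent of \<open>f\<close>.\<close>
  define D where "D s = (\<lambda>k. T (from_nat k)) ` {..<s}" for s
  have finite_D: "finite (D s)" for s
    by (simp add: D_def)
  define B where "B s = {f. \<exists>G\<subseteq>instances M \<Psi>. finite G \<and> card G \<le> s \<and>
    X f \<in> bool_comb (univ M) (G \<union> D s)}" for s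
  have "f \<in> (\<Union>s. B s)" for f
  proof -
    have "X f \<in> bool_comb (univ M) (instances M \<Psi> \<union> parameter_free_sets M)"
      unfolding X_def by (rule comb) (simp add: assignments_def P)
    then obtain H where H: "H \<subseteq> instances M \<Psi> \<union> parameter_free_sets M" "finite H"
      "X f \<in> bool_comb (univ M) H"
      using bool_comb_finite by meson
    define G where "G = H \<inter> instances M \<Psi>"
    have "\<exists>k. A = T (from_nat k)" if "A \<in> H - G" for A
    proof -
      obtain \<theta> a where "fv \<theta> \<subseteq> {0}" "A = solset M \<theta> a"
        using \<open>A \<in> H - G\<close> H(1) unfolding G_def parameter_free_sets_def by blast
      then have "A = T (from_nat (to_nat \<theta>))"
        using solset_parameter_free unfolding T_def from_nat_to_nat by metis
      then show ?thesis ..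
    qed
    then obtain k where k: "\<And>A. A \<in> H - G \<Longrightarrow> A = T (from_nat (k A))"
      by metis
    \<comment> \<open>The sum bounds the number of instances and also exceeds all indices of the
      parameter-free sets.\<close>
    define s where "s = card G + Suc (Max (insert 0 (k ` (H - G))))"
    have "A \<in> D s" if "A \<in> H - G" for A
    proof -
      have "k A \<le> Max (insert 0 (k ` (H - G)))"
        using that H(2) by (intro Max_ge) auto
      then show ?thesis
        using k[OF that] unfolding D_def s_def by auto
    qed
    then have "H \<subseteq> G \<union> D s"
      by blast
    then have "X f \<in> bool_comb (univ M) (G \<union> D s)"
      using H(3) bool_comb_mono by blast
    then have "f \<in> B s"
      using H(2) unfolding B_def by (auto intro!: exI[of _ G] simp: G_def s_def)
    then show ?thesis
      by blast
  qed
  then obtain s w where dense: "\<And>u. \<exists>f\<in>B s. extends f (w @ u)"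
    using Baire_sequences[of B] by blast
  \<comment> \<open>A finite word \<open>u\<close> is represented by a sequence in
    \<open>B s\<close> that passes through \<open>w @ u\<close>.\<close>
  then obtain q where q: "\<And>u. q u \<in> B s" "\<And>u. extends (q u) (w @ u)"
    by metis
  define K0 where "K0 = 3 * 2 ^ card (D s) - (1::nat)"
  define K where "K = (s + s) * K0"
  \<comment> \<open>This exceeds by one the depth that \<open>parity_many_changes\<close>
    permits.\<close>
  define m where "m = 4 * K + 2"
  \<comment> \<open>Sets of points become sets of words, so that the words themselves can be
    enumerated. Preimages keep the family directed.\<close>
  define pull where "pull A = {u. P (q u) \<in> A}" for A
  have in_pull: "u \<in> pull A \<longleftrightarrow> P (q u) \<in> A" for u A
    by (simp add: pull_def)
  have "directed_family (pull ` instances M \<Psi>)"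
    using dir unfolding directed_family_def pull_def by fast
  then obtain us where us: "set us = words (m + 2)"
    and few: "\<forall>B\<in>pull ` instances M \<Psi> \<union> pull ` D s.
      changes (map (\<lambda>u. u \<in> B) us) \<le> 3 * 2 ^ card (pull ` D s) - 1"
    using few_changes_enumeration[of "pull ` D s" "words (m + 2)" "pull ` instances M \<Psi>"]
      finite_D finite_words by blast
  have ch: "changes (map (\<lambda>u. P (q u) \<in> A) us) \<le> K0" if "A \<in> instances M \<Psi> \<union> D s" for A
  proof -
    have "pull A \<in> pull ` instances M \<Psi> \<union> pull ` D s"
      using that by blast
    then have "changes (map (\<lambda>u. P (q u) \<in> A) us) \<le> 3 * 2 ^ card (pull ` D s) - 1"
      using bspec[OF few, of "pull A"] by (simp only: in_pull)
    \<comment> \<open>\<open>pull\<close> may identify sets, which only lowers the bound.\<close>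
    moreover have "(2::nat) ^ card (pull ` D s) \<le> 2 ^ card (D s)"
      by (intro power_increasing) (auto simp: card_image_le finite_D)
    ultimately show ?thesis
      unfolding K0_def by linarith
  qed
  have "changes (map (\<lambda>u. P (q u) \<in> X (q v)) us) \<le> K" for v
  proof -
    obtain G where G: "G \<subseteq> instances M \<Psi>" "finite G" "card G \<le> s"
      "X (q v) \<in> bool_comb (univ M) (G \<union> D s)"
      using q(1)[of v] unfolding B_def by blast
    have "changes (map (\<lambda>u. P (q u) \<in> X (q v)) us) \<le>
        (\<Sum>A\<in>G \<union> D s. changes (map (\<lambda>u. P (q u) \<in> A) us))"
      using G P by (intro changes_bool_comb) (auto simp: finite_D)
    also have "\<dots> \<le> of_nat (card (G \<union> D s)) * K0"
      using G ch by (intro sum_bounded_above) auto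
    also have "card (G \<union> D s) \<le> s + s"
      using card_Un_le[of G "D s"] G(3) card_image_le[of "{..<s}" "\<lambda>k. T (from_nat k)"]
      unfolding D_def by simp
    finally show ?thesis
      by (simp add: K_def mult_right_mono)
  qed
  moreover have "P (q u) \<in> X (q v) \<longleftrightarrow> even (length w + j)"
    if "u \<in> words (m + 2)" "v \<in> words (m + 2)" "j < m + 2" "splits_at j ((!) u) ((!) v)" for u v j
  proof -
    have "q u i = (w @ u) ! i" "q v i = (w @ v) ! i" if "i \<le> length w + j" for i
      using q(2)[of u] q(2)[of v] that \<open>u \<in> _\<close> \<open>v \<in> _\<close> \<open>j < _\<close>
      by (auto simp: extends_def words_def)
    \<comment> \<open>The common stem \<open>w\<close> shifts all splitting levels by its
      length.\<close>
    then have "splits_at (length w + j) (q u) (q v)"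
      using \<open>splits_at j _ _\<close> by (auto simp: splits_at_def nth_append)
    then show ?thesis
      unfolding X_def by (rule \<phi>)
  qed
  ultimately have "m \<le> 4 * K + 1"
    using us by (intro parity_many_changes[where R = "\<lambda>u v. P (q u) \<in> X (q v)" and d = "length w"]) auto
  then show False
    by (simp add: m_def)
qed


section \<open>Valued fields\<close>

text \<open>The language has no subtraction, so variable 2 stands for the difference x - y through x
  = y + d. Its valuation is even when it equals that of a square, and equality of valuations is
  divisibility both ways.\<close>

definition even_distance :: fm where
  "even_distance = Exi 2 (Exi 3 (Conj (Eq (Var 0) (Add (Var 1) (Var 2)))
    (Conj (Dvd (Var 2) (Mul (Var 3) (Var 3))) (Dvd (Mul (Var 3) (Var 3)) (Var 2)))))"

lemma solset_even_distance:
  "x \<in> solset (valued_structure U pl ti v) even_distance (\<lambda>_. y) \<longleftrightarrow>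
    x \<in> U \<and> (\<exists>d\<in>U. \<exists>z\<in>U. x = pl y d \<and> v d = v (ti z z))"
proof -
  have "(v d \<le> v (ti z z) \<and> v (ti z z) \<le> v d) = (v d = v (ti z z))" for d z
    by auto
  then show ?thesis
    by (simp add: solset_def valued_structure_def even_distance_def)
qed

lemma is_structure_valued_structure:
  "x \<in> U \<Longrightarrow> (\<And>a b. a \<in> U \<Longrightarrow> b \<in> U \<Longrightarrow> pl a b \<in> U) \<Longrightarrow>
    (\<And>a b. a \<in> U \<Longrightarrow> b \<in> U \<Longrightarrow> ti a b \<in> U) \<Longrightarrow> is_structure (valued_structure U pl ti v)"
  by (auto simp: is_structure_def valued_structure_def)


subsection \<open>Laurent series\<close>

text \<open>The digits 0 and 1 are distinct in every field, so two such series differ by 1 or -1 at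
  the first splitting exponent.\<close>

definition fls_digits :: "(nat \<Rightarrow> bool) \<Rightarrow> 'k::field fls" where
  "fls_digits f = fps_to_fls (Abs_fps (\<lambda>i. if f i then 1 else 0))"

lemma fls_val_digits_diff:
  assumes "splits_at j f g"
  shows "fls_val (fls_digits f - fls_digits g :: 'k::field fls) = Fin (int j)"
proof -
  let ?d = "fls_digits f - fls_digits g :: 'k fls"
  have nz: "fls_nth ?d (int j) \<noteq> 0"
    using assms by (auto simp: fls_digits_def splits_at_def)
  have "fls_nth ?d k = 0" if "k < int j" for k
    using assms that by (auto simp: fls_digits_def splits_at_def)
  then have "fls_subdegree ?d = int j"
    using nz by (intro fls_subdegree_eqI)
  moreover have "?d \<noteq> 0"
    using nz by (metis fls_zero_nth)
  ultimately show ?thesis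
    by (simp add: fls_val_def)
qed

lemma fls_val_square: "fls_val (z * z) = fls_val z + fls_val (z :: 'k::field fls)"
  by (auto simp: fls_val_def)

lemma laurent_even_distance:
  assumes "splits_at j f g"
  shows "fls_digits f \<in> solset (laurent :: 'k::field fls vstruct) even_distance (\<lambda>_. fls_digits g)
    \<longleftrightarrow> even j"
proof -
  have "x = y + d \<longleftrightarrow> d = x - y" for x y d :: "'k fls"
    by (auto simp: algebra_simps)
  then have "fls_digits f \<in> solset (laurent :: 'k fls vstruct) even_distance (\<lambda>_. fls_digits g) \<longleftrightarrow>
      (\<exists>z :: 'k fls. Fin (int j) = fls_val z + fls_val z)"
    by (simp add: laurent_def solset_even_distance fls_val_digits_diff[OF assms] fls_val_square)
  also have "\<dots> \<longleftrightarrow> even j"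
  proof
    assume "\<exists>z :: 'k fls. Fin (int j) = fls_val z + fls_val z"
    then have "\<exists>k. int j = k + k"
      by (auto simp: fls_val_def split: if_splits)
    then show "even j"
      by presburger
  next
    assume "even j"
    then obtain i where "j = i + i"
      by (metis evenE mult_2)
    moreover have "fls_val (fls_X_intpow (int i) :: 'k fls) = Fin (int i)"
      by (simp add: fls_val_def)
    \<comment> \<open>The witness is the power t^i with i = j / 2.\<close>
    ultimately show "\<exists>z :: 'k fls. Fin (int j) = fls_val z + fls_val z"
      by (intro exI[of _ "fls_X_intpow (int i)"]) simp
  qed
  finally show ?thesis .
qed

lemma not_quasi_VC_minimal_laurent:
  assumes "infinite (UNIV :: 'm set)"
  shows "\<not> quasi_VC_minimal TYPE('m) (Th (laurent :: 'k::field fls vstruct))"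
  using assms
proof (rule not_quasi_VC_minimal[OF _ _ _ laurent_even_distance])
  show "is_structure (laurent :: 'k fls vstruct)"
    unfolding laurent_def by (rule is_structure_valued_structure) auto
  show "fls_digits f \<in> univ (laurent :: 'k fls vstruct)" for f
    by (simp add: laurent_def valued_structure_def)
qed


subsection \<open>The $p$-adic numbers\<close>

context
  fixes p :: nat
  assumes prime_p: "prime p"
begin

section \<open>The valuation of the rationals\<close>

lemma prime_elem_p: "prime_elem (int p)"
  using prime_p by auto

text \<open>Cross-multiplying with the reduced fraction gives \<open>a * d = n * b\<close>, and
  multiplicities are additive because p is prime. The valuation can thus be read off any
  representation.\<close>

lemma rat_val_quotient:
  assumes "a \<noteq> 0" "b \<noteq> 0"
  shows "rat_val p (of_int a / of_int b) =
    Fin (int (multiplicity (int p) a) - int (multiplicity (int p) b))"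
proof -
  obtain n d where nd: "quotient_of (of_int a / of_int b) = (n, d)"
    by fastforce
  have d: "d > 0"
    using quotient_of_denom_pos[OF nd] .
  have eq: "of_int a / of_int b = (of_int n / of_int d :: rat)"
    using quotient_of_div[OF nd] .
  then have "of_int (a * d) = (of_int (n * b) :: rat)"
    using assms d by (simp add: field_simps)
  then have ad: "a * d = n * b"
    by (simp only: of_int_eq_iff)
  then have "n \<noteq> 0"
    using assms d by auto
  have "multiplicity (int p) (a * d) = multiplicity (int p) (n * b)"
    using ad by simp
  then have "multiplicity (int p) a + multiplicity (int p) d =
      multiplicity (int p) n + multiplicity (int p) b"
    using assms d \<open>n \<noteq> 0\<close> by (simp add: prime_elem_multiplicity_mult_distrib[OF prime_elem_p])
  then show ?thesis
    using assms by (simp add: rat_val_def nd)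
qed

lemma rat_cases:
  obtains a b where "b \<noteq> 0" "x = of_int a / (of_int b :: rat)"
  by (metis of_int_eq_0_iff quotient_of_div quotient_of_denom_pos less_irrefl surj_pair)

lemma rat_val_0: "rat_val p 0 = Pinf"
  by (simp add: rat_val_def)

lemma rat_val_mult: "rat_val p (x * y) = rat_val p x + rat_val p y"
proof (cases "x = 0 \<or> y = 0")
  case True
  then show ?thesis
    by (auto simp: rat_val_def)
next
  case False
  obtain a b c d where "b \<noteq> 0" "x = of_int a / of_int b" "d \<noteq> 0" "y = of_int c / of_int d"
    by (metis rat_cases)
  moreover from this have "x * y = of_int (a * c) / of_int (b * d)"
    by simp
  moreover have "a \<noteq> 0" "c \<noteq> 0"
    using False calculation by auto
  ultimately show ?thesis
    by (simp add: rat_val_quotient prime_elem_multiplicity_mult_distrib[OF prime_elem_p]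
        del: of_int_mult)
qed

lemma rat_val_minus: "rat_val p (- x) = rat_val p x"
proof (cases "x = 0")
  case False
  obtain a b where ab: "b \<noteq> 0" "x = of_int a / of_int b"
    by (rule rat_cases)
  then have "- x = of_int (- a) / of_int b" "a \<noteq> 0"
    using False by auto
  then show ?thesis
    using ab rat_val_quotient[of "- a" b] rat_val_quotient[of a b] by simp
qed simp

lemma rat_val_diff_commute: "rat_val p (x - y) = rat_val p (y - x)"
  using rat_val_minus[of "x - y"] by simp

text \<open>The ultrametric inequality, phrased with a finite lower bound so that the value of 0
  needs no separate treatment later. Over the common denominator \<open>b * d\<close>, a power of p
  that divides both numerators divides their sum.\<close>

lemma rat_val_add:
  assumes "Fin k \<le> rat_val p x" "Fin k \<le> rat_val p y"
  shows "Fin k \<le> rat_val p (x + y)"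
proof (cases "x = 0 \<or> y = 0 \<or> x + y = 0")
  case True
  then show ?thesis
    using assms by (auto simp: rat_val_0)
next
  case False
  obtain a b c d where *: "b \<noteq> 0" "x = of_int a / of_int b" "d \<noteq> 0" "y = of_int c / of_int d"
    by (metis rat_cases)
  have x: "x = of_int (a * d) / of_int (b * d)" and y: "y = of_int (c * b) / of_int (b * d)"
    and xy: "x + y = of_int (a * d + c * b) / of_int (b * d)"
    using * by (simp_all add: field_simps)
  have nz: "a * d \<noteq> 0" "c * b \<noteq> 0" "a * d + c * b \<noteq> 0" "b * d \<noteq> 0"
    using False * unfolding xy by (auto simp del: of_int_mult of_int_add)
  define m where "m = min (multiplicity (int p) (a * d)) (multiplicity (int p) (c * b))"
  have "int p ^ m dvd a * d" "int p ^ m dvd c * b"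
    by (simp_all add: m_def multiplicity_dvd')
  then have "int p ^ m dvd a * d + c * b"
    by (rule dvd_add)
  then have "m \<le> multiplicity (int p) (a * d + c * b)"
    using nz(3) prime_elem_p by (intro multiplicity_geI) auto
  moreover have "k \<le> int m - int (multiplicity (int p) (b * d))"
    using assms rat_val_quotient[OF nz(1,4)] rat_val_quotient[OF nz(2,4)]
    unfolding x[symmetric] y[symmetric] m_def by simp
  ultimately show ?thesis
    using rat_val_quotient[OF nz(3,4)] unfolding xy[symmetric] by simp
qed

lemma rat_val_diff:
  "Fin k \<le> rat_val p x \<Longrightarrow> Fin k \<le> rat_val p y \<Longrightarrow> Fin k \<le> rat_val p (x - y)"
  using rat_val_add[of k x "- y"] by (simp add: rat_val_minus)

lemma rat_val_mult_ge:
  "Fin k \<le> rat_val p x \<Longrightarrow> Fin l \<le> rat_val p y \<Longrightarrow> Fin (k + l) \<le> rat_val p (x * y)"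
  by (cases "rat_val p x"; cases "rat_val p y") (auto simp: rat_val_mult)

text \<open>A perturbation of larger valuation changes nothing: if \<open>y\<close> had value above
  \<open>j\<close>, then so would \<open>x = y - (y - x)\<close>.\<close>

lemma rat_val_dominant:
  assumes "rat_val p x = Fin j" "Fin (j + 1) \<le> rat_val p (y - x)"
  shows "rat_val p y = Fin j"
proof -
  have "Fin j \<le> rat_val p (y - x)"
    using assms(2) by (cases "rat_val p (y - x)") auto
  then have "Fin j \<le> rat_val p y"
    using rat_val_add[of j "y - x" x] assms(1) by simp
  moreover have "\<not> Fin (j + 1) \<le> rat_val p y"
    using rat_val_diff[of "j + 1" y "y - x"] assms by auto
  ultimately show ?thesis
    by (cases "rat_val p y") auto
qed

lemma rat_val_sum:
  "(\<And>i. i \<in> A \<Longrightarrow> Fin k \<le> rat_val p (h i)) \<Longrightarrow> Fin k \<le> rat_val p (sum h A)"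
  by (induction A rule: infinite_finite_induct) (auto simp: rat_val_0 rat_val_add)

lemma rat_val_power: "rat_val p (of_nat p ^ i) = Fin (int i)"
proof -
  have "p > 1"
    using prime_gt_1_nat[OF prime_p] .
  then have "rat_val p (of_int (int p ^ i) / of_int 1) =
      Fin (int (multiplicity (int p) (int p ^ i)) - int (multiplicity (int p) 1))"
    by (intro rat_val_quotient) auto
  then show ?thesis
    using \<open>p > 1\<close> by (simp add: multiplicity_same_power)
qed

section \<open>Cauchy sequences and null sequences\<close>

lemma padic_CauchyD:
  assumes "x \<in> padic_Cauchy p"
  obtains N where "\<And>m n. m \<ge> N \<Longrightarrow> n \<ge> N \<Longrightarrow> Fin k \<le> rat_val p (x m - x n)"
  using assms unfolding padic_Cauchy_def by blast

lemma padic_nullD: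
  assumes "x \<in> padic_null p"
  obtains N where "\<And>n. n \<ge> N \<Longrightarrow> Fin k \<le> rat_val p (x n)"
  using assms unfolding padic_null_def by blast

lemma padic_CauchyI:
  assumes "\<And>k. \<exists>N. \<forall>n m. N \<le> n \<longrightarrow> n \<le> m \<longrightarrow> Fin k \<le> rat_val p (x m - x n)"
  shows "x \<in> padic_Cauchy p"
proof -
  have "\<exists>N. \<forall>m\<ge>N. \<forall>n\<ge>N. Fin k \<le> rat_val p (x m - x n)" for k
  proof -
    obtain N where N: "\<And>n m. N \<le> n \<Longrightarrow> n \<le> m \<Longrightarrow> Fin k \<le> rat_val p (x m - x n)"
      using assms by blast
    have "Fin k \<le> rat_val p (x m - x n)" if "m \<ge> N" "n \<ge> N" for m n
      using N[of n m] N[of m n] that rat_val_diff_commute[of "x m" "x n"] by (cases "n \<le> m") auto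
    then show ?thesis
      by blast
  qed
  then show ?thesis
    unfolding padic_Cauchy_def by blast
qed

lemma padic_null_Cauchy: "x \<in> padic_null p \<Longrightarrow> x \<in> padic_Cauchy p"
proof (rule padic_CauchyI)
  fix k assume "x \<in> padic_null p"
  then obtain N where "\<And>n. n \<ge> N \<Longrightarrow> Fin k \<le> rat_val p (x n)"
    using padic_nullD by blast
  then show "\<exists>N. \<forall>n m. N \<le> n \<longrightarrow> n \<le> m \<longrightarrow> Fin k \<le> rat_val p (x m - x n)"
    by (intro exI[of _ N]) (auto intro: rat_val_diff)
qed

lemma padic_null_add:
  assumes "x \<in> padic_null p" "y \<in> padic_null p"
  shows "(\<lambda>n. x n + y n) \<in> padic_null p"
proof -
  have "\<exists>N. \<forall>n\<ge>N. Fin k \<le> rat_val p (x n + y n)" for k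
  proof -
    obtain M N where "\<And>n. n \<ge> M \<Longrightarrow> Fin k \<le> rat_val p (x n)" "\<And>n. n \<ge> N \<Longrightarrow> Fin k \<le> rat_val p (y n)"
      using padic_nullD[OF assms(1), of k] padic_nullD[OF assms(2), of k] by metis
    then show ?thesis
      by (intro exI[of _ "max M N"]) (simp add: rat_val_add)
  qed
  then show ?thesis
    unfolding padic_null_def by blast
qed

lemma padic_null_minus: "(\<lambda>n. x n - y n) \<in> padic_null p \<Longrightarrow> (\<lambda>n. y n - x n) \<in> padic_null p"
  unfolding padic_null_def by (simp add: rat_val_diff_commute)

definition eventual_val :: "(nat \<Rightarrow> rat) \<Rightarrow> int \<Rightarrow> bool" where
  "eventual_val x j \<longleftrightarrow> (\<exists>N. \<forall>n\<ge>N. rat_val p (x n) = Fin j)"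

lemma eventual_val_not_null:
  assumes "eventual_val x j"
  shows "x \<notin> padic_null p"
proof
  assume "x \<in> padic_null p"
  then obtain N where N: "\<And>n. n \<ge> N \<Longrightarrow> Fin (j + 1) \<le> rat_val p (x n)"
    using padic_nullD by blast
  obtain M where M: "\<And>n. n \<ge> M \<Longrightarrow> rat_val p (x n) = Fin j"
    using assms unfolding eventual_val_def by blast
  show False
    using N[of "max M N"] M[of "max M N"] by simp
qed

text \<open>If the sequence is not null, terms of value below some \<open>k\<close> occur
  arbitrarily late. Beyond the point where all differences have value at least \<open>k\<close>, one
  such term fixes the value of all others.\<close>

lemma padic_Cauchy_cases:
  assumes "x \<in> padic_Cauchy p"
  obtains (null) "x \<in> padic_null p" | (val) j where "eventual_val x j"
proof (cases "x \<in> padic_null p")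
  case False
  then obtain k where k: "\<And>N. \<exists>n\<ge>N. \<not> Fin k \<le> rat_val p (x n)"
    unfolding padic_null_def by blast
  obtain N where N: "\<And>m n. m \<ge> N \<Longrightarrow> n \<ge> N \<Longrightarrow> Fin k \<le> rat_val p (x m - x n)"
    using padic_CauchyD[OF assms, where k = k] by blast
  obtain n where n: "n \<ge> N" "\<not> Fin k \<le> rat_val p (x n)"
    using k by blast
  then obtain j where j: "rat_val p (x n) = Fin j" "j + 1 \<le> k"
    by (cases "rat_val p (x n)") (auto simp: rat_val_def split: if_splits)
  have "rat_val p (x m) = Fin j" if "m \<ge> N" for m
  proof (rule rat_val_dominant[OF j(1)])
    show "Fin (j + 1) \<le> rat_val p (x m - x n)"
      using N[OF that n(1)] j(2) by (cases "rat_val p (x m - x n)") auto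
  qed
  then show ?thesis
    using val unfolding eventual_val_def by blast
qed (rule null)

lemma eventual_val_mult:
  assumes "eventual_val x j" "eventual_val y k"
  shows "eventual_val (\<lambda>n. x n * y n) (j + k)"
proof -
  obtain M N where "\<And>n. n \<ge> M \<Longrightarrow> rat_val p (x n) = Fin j" "\<And>n. n \<ge> N \<Longrightarrow> rat_val p (y n) = Fin k"
    using assms unfolding eventual_val_def by blast
  then show ?thesis
    unfolding eventual_val_def by (intro exI[of _ "max M N"]) (simp add: rat_val_mult)
qed

lemma eventual_val_cong:
  assumes "eventual_val x j" "(\<lambda>n. y n - x n) \<in> padic_null p"
  shows "eventual_val y j"
proof -
  obtain M where M: "\<And>n. n \<ge> M \<Longrightarrow> rat_val p (x n) = Fin j"
    using assms(1) unfolding eventual_val_def by blast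
  obtain N where N: "\<And>n. n \<ge> N \<Longrightarrow> Fin (j + 1) \<le> rat_val p (y n - x n)"
    using padic_nullD[OF assms(2), where k = "j + 1"] by blast
  have "rat_val p (y n) = Fin j" if "n \<ge> max M N" for n
    by (rule rat_val_dominant[OF M N]) (use that in auto)
  then show ?thesis
    unfolding eventual_val_def by blast
qed

lemma padic_Cauchy_bounded:
  assumes "x \<in> padic_Cauchy p"
  obtains b N where "\<And>n. n \<ge> N \<Longrightarrow> Fin b \<le> rat_val p (x n)"
  using assms
proof (cases rule: padic_Cauchy_cases)
  case null
  then show ?thesis
    using padic_nullD[of x 0] that by blast
next
  case (val j)
  then show ?thesis
    unfolding eventual_val_def by (metis that order_refl)
qed

lemma padic_null_mult:
  assumes "x \<in> padic_Cauchy p" "y \<in> padic_null p"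
  shows "(\<lambda>n. x n * y n) \<in> padic_null p"
proof -
  obtain b M where M: "\<And>n. n \<ge> M \<Longrightarrow> Fin b \<le> rat_val p (x n)"
    using padic_Cauchy_bounded[OF assms(1)] by blast
  have "\<exists>N. \<forall>n\<ge>N. Fin k \<le> rat_val p (x n * y n)" for k
  proof -
    obtain N where N: "\<And>n. n \<ge> N \<Longrightarrow> Fin (k - b) \<le> rat_val p (y n)"
    using padic_nullD[OF assms(2), where k = "k - b"] by blast
    have "Fin k \<le> rat_val p (x n * y n)" if "n \<ge> max M N" for n
      using rat_val_mult_ge[OF M[of n] N[of n]] that by simp
    then show ?thesis
      by blast
  qed
  then show ?thesis
    unfolding padic_null_def by blast
qed

lemma padic_Cauchy_add:
  assumes "x \<in> padic_Cauchy p" "y \<in> padic_Cauchy p"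
  shows "(\<lambda>n. x n + y n) \<in> padic_Cauchy p"
proof (rule padic_CauchyI)
  fix k
  obtain M where M: "\<And>m n. m \<ge> M \<Longrightarrow> n \<ge> M \<Longrightarrow> Fin k \<le> rat_val p (x m - x n)"
    using padic_CauchyD[OF assms(1), where k = k] by blast
  obtain N where N: "\<And>m n. m \<ge> N \<Longrightarrow> n \<ge> N \<Longrightarrow> Fin k \<le> rat_val p (y m - y n)"
    using padic_CauchyD[OF assms(2), where k = k] by blast
  have "Fin k \<le> rat_val p (x m + y m - (x n + y n))" if "n \<ge> max M N" "m \<ge> n" for m n
    using rat_val_add[OF M[of m n] N[of m n]] that by (simp add: algebra_simps)
  then show "\<exists>N. \<forall>n m. N \<le> n \<longrightarrow> n \<le> m \<longrightarrow> Fin k \<le> rat_val p (x m + y m - (x n + y n))"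
    by blast
qed

lemma padic_Cauchy_mult:
  assumes "x \<in> padic_Cauchy p" "y \<in> padic_Cauchy p"
  shows "(\<lambda>n. x n * y n) \<in> padic_Cauchy p"
proof (rule padic_CauchyI)
  fix k
  obtain a A where A: "\<And>n. n \<ge> A \<Longrightarrow> Fin a \<le> rat_val p (x n)"
    using padic_Cauchy_bounded[OF assms(1)] by blast
  obtain b B where B: "\<And>n. n \<ge> B \<Longrightarrow> Fin b \<le> rat_val p (y n)"
    using padic_Cauchy_bounded[OF assms(2)] by blast
  obtain M where M: "\<And>m n. m \<ge> M \<Longrightarrow> n \<ge> M \<Longrightarrow> Fin (k - b) \<le> rat_val p (x m - x n)"
    using padic_CauchyD[OF assms(1), where k = "k - b"] by blast
  obtain N where N: "\<And>m n. m \<ge> N \<Longrightarrow> n \<ge> N \<Longrightarrow> Fin (k - a) \<le> rat_val p (y m - y n)"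
    using padic_CauchyD[OF assms(2), where k = "k - a"] by blast
  have "Fin k \<le> rat_val p (x m * y m - x n * y n)"
    if "n \<ge> max (max A B) (max M N)" "m \<ge> n" for m n
  proof -
    have "Fin k \<le> rat_val p (x m * (y m - y n))"
      using rat_val_mult_ge[OF A[of m] N[of m n]] that by simp
    moreover have "Fin k \<le> rat_val p ((x m - x n) * y n)"
      using rat_val_mult_ge[OF M[of m n] B[of n]] that by simp
    moreover have "x m * y m - x n * y n = x m * (y m - y n) + (x m - x n) * y n"
      by (simp add: algebra_simps)
    ultimately show ?thesis
      using rat_val_add by metis
  qed
  then show "\<exists>N. \<forall>n m. N \<le> n \<longrightarrow> n \<le> m \<longrightarrow> Fin k \<le> rat_val p (x m * y m - x n * y n)"
    by blast
qed

lemma padic_Cauchy_const: "(\<lambda>_. c) \<in> padic_Cauchy p"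
  by (rule padic_CauchyI) (simp add: rat_val_0)

lemma padic_Cauchy_diff:
  assumes "x \<in> padic_Cauchy p" "y \<in> padic_Cauchy p"
  shows "(\<lambda>n. x n - y n) \<in> padic_Cauchy p"
  using padic_Cauchy_add[OF assms(1) padic_Cauchy_mult[OF padic_Cauchy_const[of "-1"] assms(2)]]
  by simp

section \<open>Classes of Cauchy sequences: operations and valuation\<close>

lemma equiv_padic_rel: "equiv (padic_Cauchy p) (padic_rel p)"
proof (rule equivI)
  show "padic_rel p \<subseteq> padic_Cauchy p \<times> padic_Cauchy p"
    by (auto simp: padic_rel_def)
  show "refl_on (padic_Cauchy p) (padic_rel p)"
    by (auto simp: refl_on_def padic_rel_def padic_null_def rat_val_0)
  show "sym (padic_rel p)"
    by (auto simp: sym_def padic_rel_def padic_null_minus)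
  show "trans (padic_rel p)"
  proof (rule transI)
    fix x y z assume "(x, y) \<in> padic_rel p" "(y, z) \<in> padic_rel p"
    then show "(x, z) \<in> padic_rel p"
      using padic_null_add[of "\<lambda>n. x n - y n" "\<lambda>n. y n - z n"] by (auto simp: padic_rel_def)
  qed
qed

abbreviation padic_class :: "(nat \<Rightarrow> rat) \<Rightarrow> (nat \<Rightarrow> rat) set" where
  "padic_class x \<equiv> padic_rel p `` {x}"

lemma padic_class_in: "x \<in> padic_Cauchy p \<Longrightarrow> padic_class x \<in> padic_carrier p"
  by (simp add: padic_carrier_def quotientI)

lemma padic_class_eqD:
  "padic_class x = padic_class y \<Longrightarrow> x \<in> padic_Cauchy p \<Longrightarrow> y \<in> padic_Cauchy p \<Longrightarrow>
    (\<lambda>n. x n - y n) \<in> padic_null p"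
  using eq_equiv_class_iff[OF equiv_padic_rel] by (auto simp: padic_rel_def)

lemma padic_carrier_cases:
  assumes "A \<in> padic_carrier p"
  obtains x where "x \<in> padic_Cauchy p" "A = padic_class x"
  using assms unfolding padic_carrier_def by (rule quotientE)

lemma padic_add_class:
  assumes "x \<in> padic_Cauchy p" "y \<in> padic_Cauchy p"
  shows "padic_add p (padic_class x) (padic_class y) = padic_class (\<lambda>n. x n + y n)"
  unfolding padic_add_def
proof (rule UN_equiv_class2[OF equiv_padic_rel equiv_padic_rel _ assms])
  show "congruent2 (padic_rel p) (padic_rel p) (\<lambda>x y. padic_class (\<lambda>n. x n + y n))"
  proof (rule congruent2I')
    fix x x' y y' assume xy: "(x, x') \<in> padic_rel p" "(y, y') \<in> padic_rel p"
    then have "(\<lambda>n. (x n - x' n) + (y n - y' n)) \<in> padic_null p"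
      by (auto simp: padic_rel_def intro: padic_null_add)
    then have "((\<lambda>n. x n + y n), (\<lambda>n. x' n + y' n)) \<in> padic_rel p"
      using xy by (auto simp: padic_rel_def padic_Cauchy_add algebra_simps)
    then show "padic_class (\<lambda>n. x n + y n) = padic_class (\<lambda>n. x' n + y' n)"
      by (rule equiv_class_eq[OF equiv_padic_rel])
  qed
qed

lemma padic_mul_class:
  assumes "x \<in> padic_Cauchy p" "y \<in> padic_Cauchy p"
  shows "padic_mul p (padic_class x) (padic_class y) = padic_class (\<lambda>n. x n * y n)"
  unfolding padic_mul_def
proof (rule UN_equiv_class2[OF equiv_padic_rel equiv_padic_rel _ assms])
  show "congruent2 (padic_rel p) (padic_rel p) (\<lambda>x y. padic_class (\<lambda>n. x n * y n))"
  proof (rule congruent2I')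
    fix x x' y y' assume xy: "(x, x') \<in> padic_rel p" "(y, y') \<in> padic_rel p"
    then have "(\<lambda>n. x n * (y n - y' n) + y' n * (x n - x' n)) \<in> padic_null p"
      by (intro padic_null_add padic_null_mult) (auto simp: padic_rel_def)
    then have "((\<lambda>n. x n * y n), (\<lambda>n. x' n * y' n)) \<in> padic_rel p"
      using xy by (auto simp: padic_rel_def padic_Cauchy_mult algebra_simps)
    then show "padic_class (\<lambda>n. x n * y n) = padic_class (\<lambda>n. x' n * y' n)"
      by (rule equiv_class_eq[OF equiv_padic_rel])
  qed
qed

text \<open>The class of a null sequence is exactly \<open>padic_null p\<close>, the set that
  \<open>padic_val\<close> singles out for the value \<open>Pinf\<close>.\<close>

lemma padic_val_null:
  assumes "x \<in> padic_null p"
  shows "padic_val p (padic_class x) = Pinf"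
proof -
  have "y \<in> padic_class x \<longleftrightarrow> y \<in> padic_null p" for y
  proof
    assume "y \<in> padic_class x"
    then have "(\<lambda>n. y n - x n) \<in> padic_null p"
      by (auto simp: padic_rel_def intro: padic_null_minus)
    then show "y \<in> padic_null p"
      using padic_null_add[OF assms, of "\<lambda>n. y n - x n"] by simp
  next
    assume y: "y \<in> padic_null p"
    then have "(\<lambda>n. x n - y n) \<in> padic_null p"
      using padic_null_add[OF assms padic_null_minus[of y "\<lambda>_. 0"]] by simp
    then show "y \<in> padic_class x"
      using assms y by (auto simp: padic_rel_def padic_null_Cauchy)
  qed
  then have "padic_class x = padic_null p"
    by blast
  then show ?thesis
    by (simp add: padic_val_def)
qed

lemma padic_val_eventual:
  assumes "x \<in> padic_Cauchy p" "eventual_val x j"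
  shows "padic_val p (padic_class x) = Fin j"
proof -
  have x: "x \<in> padic_class x"
    using assms(1) equiv_class_self[OF equiv_padic_rel] by blast
  then have "padic_class x \<noteq> padic_null p"
    using eventual_val_not_null[OF assms(2)] by blast
  moreover have "(THE w. \<forall>y\<in>padic_class x. \<exists>N. \<forall>n\<ge>N. rat_val p (y n) = w) = Fin j"
  proof (rule the_equality)
    show "\<forall>y\<in>padic_class x. \<exists>N. \<forall>n\<ge>N. rat_val p (y n) = Fin j"
    proof
      fix y assume "y \<in> padic_class x"
      then have "(\<lambda>n. y n - x n) \<in> padic_null p"
        by (auto simp: padic_rel_def intro: padic_null_minus)
      then show "\<exists>N. \<forall>n\<ge>N. rat_val p (y n) = Fin j"
        using eventual_val_cong[OF assms(2)] unfolding eventual_val_def by blast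
    qed
  next
    fix w assume "\<forall>y\<in>padic_class x. \<exists>N. \<forall>n\<ge>N. rat_val p (y n) = w"
    then show "w = Fin j"
      using x assms(2) unfolding eventual_val_def by (metis nat_le_linear)
  qed
  ultimately show ?thesis
    by (simp add: padic_val_def)
qed

section \<open>The Cantor set of digit expansions in the p-adic numbers\<close>

text \<open>These represent the p-adic integers whose digits are all 0 or 1, for every p
  alike.\<close>

definition partial_sums :: "(nat \<Rightarrow> bool) \<Rightarrow> nat \<Rightarrow> rat" where
  "partial_sums f n = (\<Sum>i<n. of_bool (f i) * of_nat p ^ i)"

lemma rat_val_digit: "k \<le> i \<Longrightarrow> Fin (int k) \<le> rat_val p (of_bool b * of_nat p ^ i)"
  by (cases b) (simp_all add: rat_val_0 rat_val_power)

lemma partial_sums_split: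
  "k \<le> n \<Longrightarrow> partial_sums f n =
    partial_sums f k + (\<Sum>i\<in>{k..<n}. of_bool (f i) * of_nat p ^ i)"
  unfolding partial_sums_def lessThan_atLeast0 by (rule sum.atLeastLessThan_concat[symmetric]) auto

lemma rat_val_partial_sums_tail:
  "Fin (int k) \<le> rat_val p (\<Sum>i\<in>{k..<n}. of_bool (f i) * of_nat p ^ i)"
  by (rule rat_val_sum) (simp add: rat_val_digit)

lemma partial_sums_Cauchy: "partial_sums f \<in> padic_Cauchy p"
proof (rule padic_CauchyI)
  fix k :: int
  have "Fin k \<le> rat_val p (partial_sums f m - partial_sums f n)" if "nat k \<le> n" "n \<le> m" for m n
  proof -
    have "Fin k \<le> Fin (int n)"
      using that by simp
    also have "\<dots> \<le> rat_val p (partial_sums f m - partial_sums f n)"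
      using rat_val_partial_sums_tail[of n f m] partial_sums_split[OF that(2), of f] by simp
    finally show ?thesis .
  qed
  then show "\<exists>N. \<forall>n m. N \<le> n \<longrightarrow> n \<le> m \<longrightarrow> Fin k \<le> rat_val p (partial_sums f m - partial_sums f n)"
    by blast
qed

text \<open>After \<open>Suc j\<close> digits the difference is p^j up to sign, and all later digits
  contribute multiples of p^(j + 1), which cannot alter its value.\<close>

lemma eventual_val_partial_sums:
  assumes "splits_at j f g"
  shows "eventual_val (\<lambda>n. partial_sums f n - partial_sums g n) (int j)"
  unfolding eventual_val_def
proof (intro exI[of _ "Suc j"] allI impI)
  fix n assume n: "Suc j \<le> n"
  let ?d = "\<lambda>n. partial_sums f n - partial_sums g n"
  have "partial_sums f j = partial_sums g j"
    using assms unfolding partial_sums_def by (intro sum.cong) (auto simp: splits_at_def)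
  then have "?d (Suc j) = (if f j then of_nat p ^ j else - (of_nat p ^ j))"
    using assms by (auto simp: partial_sums_def splits_at_def)
  then have "rat_val p (?d (Suc j)) = Fin (int j)"
    by (simp add: rat_val_power rat_val_minus)
  then show "rat_val p (?d n) = Fin (int j)"
  proof (rule rat_val_dominant)
    show "Fin (int j + 1) \<le> rat_val p (?d n - ?d (Suc j))"
      using rat_val_diff[OF rat_val_partial_sums_tail[of "Suc j" f n]
          rat_val_partial_sums_tail[of "Suc j" g n]]
      by (simp add: partial_sums_split[OF n] add.commute)
  qed
qed

text \<open>The difference class \<open>D\<close> has value \<open>j\<close>, since its
  representative differs from that of the two points by a null sequence. A class \<open>Z\<close> is
  either null, with infinite value of its square, or has an integer value \<open>k\<close>, whence j
  = 2k.\<close>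

lemma Qp_even_distance:
  assumes "splits_at j f g"
  shows "padic_class (partial_sums f) \<in>
    solset (Qp p) even_distance (\<lambda>_. padic_class (partial_sums g)) \<longleftrightarrow> even j"
proof -
  let ?x = "partial_sums f" and ?y = "partial_sums g"
  note Cauchy = partial_sums_Cauchy[of f] partial_sums_Cauchy[of g]
  have "(\<exists>D\<in>padic_carrier p. \<exists>Z\<in>padic_carrier p.
      padic_class ?x = padic_add p (padic_class ?y) D \<and>
      padic_val p D = padic_val p (padic_mul p Z Z)) \<longleftrightarrow> even j"
  proof (intro iffI; (elim bexE conjE)?)
    fix D Z assume "D \<in> padic_carrier p" "Z \<in> padic_carrier p"
      and D: "padic_class ?x = padic_add p (padic_class ?y) D"
      and val: "padic_val p D = padic_val p (padic_mul p Z Z)"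
    then obtain d z where d: "d \<in> padic_Cauchy p" "D = padic_class d"
      and z: "z \<in> padic_Cauchy p" "Z = padic_class z"
      by (metis padic_carrier_cases)
    have "(\<lambda>n. ?x n - (?y n + d n)) \<in> padic_null p"
      using D d Cauchy by (intro padic_class_eqD) (simp_all add: padic_add_class padic_Cauchy_add)
    from padic_null_minus[OF this] have "(\<lambda>n. d n - (?x n - ?y n)) \<in> padic_null p"
      by (simp add: algebra_simps)
    then have "padic_val p D = Fin (int j)"
      using eventual_val_cong[OF eventual_val_partial_sums[OF assms]] d padic_val_eventual by simp
    then have zz: "padic_val p (padic_class (\<lambda>n. z n * z n)) = Fin (int j)"
      using val z by (simp add: padic_mul_class)
    from z(1) show "even j"
    proof (cases rule: padic_Cauchy_cases)
      case null
      then show ?thesis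
        using zz padic_val_null[OF padic_null_mult[OF z(1) null]] by simp
    next
      case (val k)
      then have "int j = k + k"
        using zz padic_val_eventual[OF padic_Cauchy_mult[OF z(1) z(1)] eventual_val_mult] by simp
      then show ?thesis
        by presburger
    qed
  next
    assume "even j"
    then obtain i where i: "j = i + i"
      by (metis evenE mult_2)
    define d where "d n = ?x n - ?y n" for n
    \<comment> \<open>The constant sequence p^i has value i, hence its square has value j.\<close>
    define z where "z = (\<lambda>_::nat. of_nat p ^ i :: rat)"
    have d: "d \<in> padic_Cauchy p" and z: "z \<in> padic_Cauchy p"
      unfolding d_def z_def by (simp_all add: padic_Cauchy_diff Cauchy padic_Cauchy_const)
    have "eventual_val d (int j)"
      unfolding d_def by (rule eventual_val_partial_sums[OF assms])
    then have vd: "padic_val p (padic_class d) = Fin (int j)"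
      by (rule padic_val_eventual[OF d])
    have "eventual_val z (int i)"
      unfolding eventual_val_def z_def by (simp add: rat_val_power)
    then have "padic_val p (padic_class (\<lambda>n. z n * z n)) = Fin (int i + int i)"
      by (intro padic_val_eventual padic_Cauchy_mult eventual_val_mult z)
    then have vz: "padic_val p (padic_mul p (padic_class z) (padic_class z)) = Fin (int j)"
      using z i by (simp add: padic_mul_class)
    have "padic_class ?x = padic_add p (padic_class ?y) (padic_class d)"
      using Cauchy d by (simp add: padic_add_class) (simp add: d_def)
    then show "\<exists>D\<in>padic_carrier p. \<exists>Z\<in>padic_carrier p.
        padic_class ?x = padic_add p (padic_class ?y) D \<and>
        padic_val p D = padic_val p (padic_mul p Z Z)"
      using vd vz padic_class_in[OF d] padic_class_in[OF z] by metis
  qed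
  then show ?thesis
    using padic_class_in[OF Cauchy(1)] by (simp add: Qp_def solset_even_distance)
qed

lemma not_quasi_VC_minimal_Qp:
  assumes "infinite (UNIV :: 'm set)"
  shows "\<not> quasi_VC_minimal TYPE('m) (Th (Qp p))"
  using assms
proof (rule not_quasi_VC_minimal[OF _ _ _ Qp_even_distance])
  show "padic_class (partial_sums f) \<in> univ (Qp p)" for f
    by (simp add: Qp_def valued_structure_def padic_class_in partial_sums_Cauchy)
  show "is_structure (Qp p)"
    unfolding Qp_def
  proof (rule is_structure_valued_structure)
    show "padic_class (\<lambda>_. 0) \<in> padic_carrier p"
      by (intro padic_class_in padic_Cauchy_const)
    fix A B assume "A \<in> padic_carrier p" "B \<in> padic_carrier p"
    then obtain x y where "x \<in> padic_Cauchy p" "A = padic_class x"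
      "y \<in> padic_Cauchy p" "B = padic_class y"
      by (metis padic_carrier_cases)
    then show "padic_add p A B \<in> padic_carrier p" "padic_mul p A B \<in> padic_carrier p"
      by (simp_all add: padic_add_class padic_mul_class padic_class_in padic_Cauchy_add
          padic_Cauchy_mult)
  qed
qed

end

theorem corollary4p8:
  assumes "infinite (UNIV :: 'm set)"
  shows "(\<forall>p::nat. prime p \<longrightarrow> \<not> quasi_VC_minimal TYPE('m) (Th (Qp p))) \<and>
         \<not> quasi_VC_minimal TYPE('m) (Th (laurent :: 'k::field fls vstruct))"
  using not_quasi_VC_minimal_Qp[OF _ assms] not_quasi_VC_minimal_laurent[OF assms] by blast

end
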